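(* Let $0<\theta<2\pi$. If $2<p_1,p_2\leq\infty$ and $\frac{1}{p_1}+\frac{1}{p_2}=\frac{1}{p}$, then there is a constant $C$ such that $$\Vert\widetilde{\mathcal{A}}^\theta(f,g)\Vert_{L^{p}(\mathbb{R}^{2})}\leq C \Vert f\Vert_{L^{p_1}(\mathbb{R}^{2})}\Vert g\Vert_{L^{p_2}(\mathbb{R}^{2})}$$ for all $f\in L^{p_1}(\mathbb{R}^2)$, $g\in L^{p_2}(\mathbb{R}^2)$. Moreover, if $2\le p_1,p_2\le\infty$ with $p_1=2$ or $p_2=2$, and $\frac{1}{p_1}+\frac{1}{p_2}=\frac{1}{p}$, then there is a constant $C$ such that $$\Vert\widetilde{\mathcal{A}}^\theta(f,g)\Vert_{L^{p,\infty}(\mathbb{R}^{2})}\leq C \Vert f\Vert_{L^{p_1,1}(\mathbb{R}^{2})}\Vert g\Vert_{L^{p_2,1}(\mathbb{R}^{2})}$$ for all $f\in L^{p_1,1}(\mathbb{R}^2)$, $g\in L^{p_2,1}(\mathbb{R}^2)$.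
   Context: For $0<\theta<2\pi$, $$\widetilde{\mathcal{A}}^\theta(f,g)(x)=\int_{\mathbb{S}^{1}}f(x-|x|y)\,g(x-|x|\Theta y)\,d\sigma(y),\qquad x\in\mathbb{R}^2,$$ where $\sigma$ is the arc length measure on the unit circle $\mathbb{S}^1\subset\mathbb{R}^2$ and $\Theta$ is the counter-clockwise rotation of $\mathbb{R}^2$ by the angle $\theta$. $L^{p,s}$ denotes the Lorentz space; $L^{\infty,1}$ is interpreted as $L^\infty$. *)

theory Defs
  imports "HOL-Analysis.Analysis" "HOL-Probability.Essential_Supremum"
begin

text \<open>Real powers on \<open>[0, \<infinity>]\<close>, only used with exponents \<open>r > 0\<close>.\<close>

definition epowr :: "ennreal \<Rightarrow> real \<Rightarrow> ennreal" where
  "epowr x r = (if x = \<infinity> then \<infinity> else ennreal (enn2real x powr r))"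

text \<open>
  Exponents \<open>p, s\<close> range over \<open>(0, \<infinity>]\<close> and have type \<^typ>\<open>ennreal\<close>, where \<open>1 / \<infinity> = 0\<close>.
  The spaces consist of functions rather than of classes modulo almost everywhere equality.
\<close>

definition Lp_norm :: "'a measure \<Rightarrow> ennreal \<Rightarrow> ('a \<Rightarrow> complex) \<Rightarrow> ennreal" where
  "Lp_norm M p f =
     (if p = \<infinity> then esssup M (\<lambda>x. ennreal (norm (f x)))
      else epowr (\<integral>\<^sup>+x. ennreal (norm (f x) powr enn2real p) \<partial>M) (1 / enn2real p))"

definition Lp_space :: "'a measure \<Rightarrow> ennreal \<Rightarrow> ('a \<Rightarrow> complex) set" where
  "Lp_space M p = {f \<in> borel_measurable M. Lp_norm M p f < \<infinity>}"

definition distr_fun :: "'a measure \<Rightarrow> ('a \<Rightarrow> complex) \<Rightarrow> ennreal \<Rightarrow> ennreal" where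
  "distr_fun M f a = emeasure M {x \<in> space M. ennreal (norm (f x)) > a}"

definition decr_rearr :: "'a measure \<Rightarrow> ('a \<Rightarrow> complex) \<Rightarrow> real \<Rightarrow> ennreal" where
  "decr_rearr M f t = Inf {a. distr_fun M f a \<le> ennreal t}"

text \<open>
  For \<open>p = \<infinity>\<close> the general formula with \<open>s < \<infinity>\<close> would only leave the functions vanishing almost
  everywhere; as usual for \<open>L\<^sup>\<infinity>\<^sup>,\<^sup>1\<close>, the space is read as \<open>L\<^sup>\<infinity>\<close> instead.
\<close>

definition lorentz_norm :: "'a measure \<Rightarrow> ennreal \<Rightarrow> ennreal \<Rightarrow> ('a \<Rightarrow> complex) \<Rightarrow> ennreal" where
  "lorentz_norm M p s f =
     (if p = \<infinity> then Lp_norm M \<infinity> f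
      else if s = \<infinity> then
        (SUP t\<in>{0<..}. ennreal (t powr (1 / enn2real p)) * decr_rearr M f t)
      else
        epowr (\<integral>\<^sup>+t\<in>{0<..}. epowr (ennreal (t powr (1 / enn2real p)) * decr_rearr M f t)
                  (enn2real s) * ennreal (1 / t) \<partial>lborel)
              (1 / enn2real s))"

definition lorentz_space :: "'a measure \<Rightarrow> ennreal \<Rightarrow> ennreal \<Rightarrow> ('a \<Rightarrow> complex) set" where
  "lorentz_space M p s = {f \<in> borel_measurable M. lorentz_norm M p s f < \<infinity>}"

text \<open>
  Arc length measure on the unit circle, as the image of Lebesgue measure under the angular
  parametrisation. It is completed because the integrands below are restrictions of Lebesgue
  measurable functions on the plane, which need not be Borel on the circle.
\<close>

definition circle_measure :: "(real^2) measure" where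
  "circle_measure =
     completion (distr (restrict_space lborel {0..<2 * pi}) (restrict_space borel (sphere 0 1))
       (\<lambda>t. vector [cos t, sin t]))"

definition rotate_ccw :: "real \<Rightarrow> real^2 \<Rightarrow> real^2" where
  "rotate_ccw \<theta> y = vector [cos \<theta> * y $ 1 - sin \<theta> * y $ 2, sin \<theta> * y $ 1 + cos \<theta> * y $ 2]"

definition circ_integrand ::
    "real \<Rightarrow> (real^2 \<Rightarrow> complex) \<Rightarrow> (real^2 \<Rightarrow> complex) \<Rightarrow> real^2 \<Rightarrow> real^2 \<Rightarrow> complex" where
  "circ_integrand \<theta> f g x y = f (x - norm x *\<^sub>R y) * g (x - norm x *\<^sub>R rotate_ccw \<theta> y)"

definition circ_avg ::
    "real \<Rightarrow> (real^2 \<Rightarrow> complex) \<Rightarrow> (real^2 \<Rightarrow> complex) \<Rightarrow> real^2 \<Rightarrow> complex" where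
  "circ_avg \<theta> f g x = (LINT y|circle_measure. circ_integrand \<theta> f g x y)"

text \<open>
  The Bochner integral of a non-integrable function is \<open>0\<close> by convention, so that the existence
  of the integral for almost every \<open>x\<close> has to be asserted separately.
\<close>

definition circ_avg_defined :: "real \<Rightarrow> (real^2 \<Rightarrow> complex) \<Rightarrow> (real^2 \<Rightarrow> complex) \<Rightarrow> bool" where
  "circ_avg_defined \<theta> f g \<longleftrightarrow>
     (AE x in lebesgue. integrable circle_measure (circ_integrand \<theta> f g x))"

end

theory Submission
  imports Defs
begin

text \<open>
  Writing \<open>y = e\<^sup>i\<^sup>t x / |x|\<close> in complex notation turns the operator into
  \<open>\<integral> f((1 - e\<^sup>i\<^sup>t) x) g((1 - e\<^sup>i\<^sup>(\<^sup>t\<^sup>+\<^sup>\<theta>\<^sup>)) x) dt\<close>, an average of products of dilated rotations of \<open>f\<close> and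
  \<open>g\<close>. By Hoelder's inequality each product has \<open>L\<^sup>p\<close> norm at most
  \<open>|1 - e\<^sup>i\<^sup>t|\<close> to the power \<open>-2/p\<^sub>1\<close> times \<open>|1 - e\<^sup>i\<^sup>(\<^sup>t\<^sup>+\<^sup>\<theta>\<^sup>)|\<close> to the power \<open>-2/p\<^sub>2\<close>. As \<open>0 < \<theta> < 2\<pi>\<close>,
  the two factors are singular at different \<open>t\<close>, and for \<open>p\<^sub>1, p\<^sub>2 > 2\<close> both singularities are
  integrable, so that Minkowski's inequality gives the strong bound.

  At the endpoint, let \<open>f\<close> and \<open>g\<close> be indicators of sets of measure \<open>a\<close> and \<open>b\<close>, and integrate over a
  set of measure \<open>c\<close>. The result is at most the integral over \<open>t\<close> of the minimum of
  \<open>a / |1 - e\<^sup>i\<^sup>t|\<^sup>2\<close>, \<open>b / |1 - e\<^sup>i\<^sup>(\<^sup>t\<^sup>+\<^sup>\<theta>\<^sup>)|\<^sup>2\<close> and \<open>c\<close>, hence at most a constant times both \<open>\<surd>(ab)\<close> and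
  \<open>\<surd>(ac)\<close>, and hence times their geometric means. The layer cake formula extends this to all \<open>f\<close> and
  \<open>g\<close> in the Lorentz spaces, and testing against superlevel sets of the result gives the weak bound.
\<close>

subsection \<open>Rotations and chords\<close>

text \<open>The circle of integration at \<open>x\<close> has centre \<open>x\<close> and passes
  through the origin. A planar null set may contain such a circle, so the average is insensitive to
  the choice of representatives of \<open>f\<close> and \<open>g\<close> only for almost every
  \<open>x\<close>. This is why Borel representatives are taken and all estimates concern an
  operator on nonnegative Borel functions with values in [0, \<infinity>]. The Jacobian |1 -
  e^(it)|^2 vanishes to second order, so its power -1/p_1 is integrable in \<open>t\<close> exactly
  for p_1 > 2. At the endpoint the divergence is cut off by the minimum: min (a / t^2) c has
  integral 2 * sqrt (a * c) over the positive axis. The bound by sqrt (a * b) needs in addition a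
  quantitative separation of the two zeros. Layers cannot simply be summed in L^(p,\<infinity>),
  which for p = 1 has no equivalent norm. Testing against a set of measure c gives an inequality
  that is additive in the tested function. With r = 1/p_2 the geometric mean used is a^(1/2) * b^r *
  c^(1/2 - r), and the integrals of a^(1/2) and b^r over all levels are multiples of the L^(2,1) and
  L^(1/r,1) norms.\<close>

lemma rotate_ccw_add: "rotate_ccw s (rotate_ccw t x) = rotate_ccw (s + t) x"
  by (simp add: rotate_ccw_def vec_eq_iff forall_2 cos_add sin_add algebra_simps)

lemma linear_rotate_ccw: "linear (rotate_ccw t)"
  by (rule linearI) (simp_all add: rotate_ccw_def vec_eq_iff forall_2 algebra_simps)

text \<open>Separates the angle, which enters only through scalars, from one fixed linear map. Joint
  measurability in angle and point, needed for every use of Fubini below, follows from this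
  form.\<close>

lemma rotate_ccw_expand: "rotate_ccw t x = cos t *\<^sub>R x + sin t *\<^sub>R rotate_ccw (pi / 2) x"
  by (simp add: rotate_ccw_def vec_eq_iff forall_2 algebra_simps)

lemma rotate_ccw_periodic: "rotate_ccw (t + 2 * pi) x = rotate_ccw t x"
  by (simp add: rotate_ccw_def)

lemma unit_vector_as_rotation:
  fixes n :: "real^2"
  assumes "norm n = 1"
  obtains a where "0 \<le> a" "a < 2 * pi" "n = rotate_ccw a (vector [1, 0])"
proof -
  have "(n $ 1)\<^sup>2 + (n $ 2)\<^sup>2 = 1"
    using assms by (simp add: norm_vec_def L2_set_def sum_2)
  then obtain a where "0 \<le> a" "a < 2 * pi" "n $ 1 = cos a" "n $ 2 = sin a"
    using sincos_total_2pi by metis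
  then show ?thesis
    by (intro that[of a]) (auto simp: rotate_ccw_def vec_eq_iff forall_2)
qed

text \<open>
  In complex notation, \<open>chord t x = (1 - e\<^sup>i\<^sup>t) x\<close> and \<open>chord_sq t = |1 - e\<^sup>i\<^sup>t|\<^sup>2\<close>, the Jacobian of
  this map.
\<close>

definition chord :: "real \<Rightarrow> real^2 \<Rightarrow> real^2" where
  "chord t x = x - rotate_ccw t x"

definition chord_sq :: "real \<Rightarrow> real" where
  "chord_sq t = 2 - 2 * cos t"

lemma chord_sq_nonneg: "0 \<le> chord_sq t"
  by (simp add: chord_sq_def)

lemma chord_expand:
  "chord t x = (1 - cos t) *\<^sub>R x - sin t *\<^sub>R rotate_ccw (pi / 2) x"
  unfolding chord_def by (subst rotate_ccw_expand) (simp add: algebra_simps)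

lemma borel_measurable_chord[measurable (raw)]:
  assumes [measurable]: "f \<in> borel_measurable M" "g \<in> borel_measurable M"
  shows "(\<lambda>z. chord (f z) (g z)) \<in> borel_measurable M"
proof -
  have [measurable]: "rotate_ccw (pi / 2) \<in> borel_measurable borel"
    by (intro borel_measurable_continuous_onI linear_continuous_on)
       (simp add: linear_linear linear_rotate_ccw)
  show ?thesis
    unfolding chord_expand by measurable
qed

lemma borel_measurable_rotate_ccw[measurable (raw)]:
  assumes [measurable]: "f \<in> borel_measurable M" "g \<in> borel_measurable M"
  shows "(\<lambda>z. rotate_ccw (f z) (g z)) \<in> borel_measurable M"
proof -
  have "(\<lambda>z. g z - chord (f z) (g z)) \<in> borel_measurable M"
    by measurable
  then show ?thesis
    by (simp add: chord_def)
qed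

lemma linear_chord: "linear (chord t)"
  unfolding chord_def by (intro linear_compose_sub linear_rotate_ccw linear_id[unfolded id_def])

text \<open>In complex notation, (1 - e^(-it)) (1 - e^(it)) = |1 - e^(it)|^2. This exhibits the
  inverse of \<open>chord t\<close> whenever the Jacobian is nonzero.\<close>

lemma chord_chord_uminus: "chord (- t) (chord t x) = chord_sq t *\<^sub>R x"
proof -
  have "sin t * sin t = 1 - cos t * cos t"
    using sin_squared_eq[of t] by (simp add: power2_eq_square)
  then have eq: "cos t * (cos t * a) + sin t * (sin t * a) = a" for a
    by (simp flip: mult.assoc distrib_right)
  show ?thesis
    by (simp add: eq chord_def chord_sq_def rotate_ccw_def vec_eq_iff forall_2 algebra_simps)
qed

lemma chord_sq_uminus: "chord_sq (- t) = chord_sq t"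
  by (simp add: chord_sq_def)

lemma chord_sq_periodic: "chord_sq (t + 2 * pi) = chord_sq t"
  by (simp add: chord_sq_def)

lemma chord_periodic: "chord (t + 2 * pi) x = chord t x"
  by (simp add: chord_def rotate_ccw_periodic)

lemma det_chord: "det (matrix (chord t)) = chord_sq t"
proof -
  have "sin t * sin t = 1 - cos t * cos t"
    using sin_squared_eq[of t] by (simp add: power2_eq_square)
  then show ?thesis
    by (simp add: det_2 matrix_def chord_def chord_sq_def rotate_ccw_def axis_def algebra_simps)
qed

text \<open>Change of variables as an identity of measures, so that it passes to all nonnegative
  Borel functions at once. Lebesgue measure is determined by its values on boxes, and the preimage
  of a box is its image under the linear inverse.\<close>

lemma lborel_chord:
  assumes "chord_sq t \<noteq> 0"
  shows "lborel = density (distr lborel borel (chord t)) (\<lambda>_. ennreal (chord_sq t))"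
proof (rule lborel_eqI)
  fix l u :: "real^2"
  assume lu: "\<And>b. b \<in> Basis \<Longrightarrow> l \<bullet> b \<le> u \<bullet> b"
  have pos: "0 < chord_sq t"
    using assms chord_sq_nonneg[of t] by simp
  \<comment> \<open>In complex notation \<open>T\<close> divides by 1 - e^(it), written as the
    conjugate over the squared modulus.\<close>
  define T where "T = (\<lambda>y. (1 / chord_sq t) *\<^sub>R chord (- t) y)"
  have TC: "T (chord t x) = x" and CT: "chord t (T y) = y" for x y
    using pos chord_chord_uminus[of t x] chord_chord_uminus[of "- t" y]
    by (simp_all add: T_def linear_scale[OF linear_chord] chord_sq_uminus)
  have T: "linear T"
    unfolding T_def by (intro linear_compose_scale_right linear_chord)
  have detT: "det (matrix T) = 1 / chord_sq t"
  proof -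
    have "matrix T = (1 / chord_sq t) *\<^sub>R matrix (chord (- t))"
      by (simp add: T_def matrix_def vec_eq_iff)
    then show ?thesis
      using pos det_chord[of "- t"] by (simp add: det_2 chord_sq_uminus field_simps)
  qed
  have chord_measurable: "chord t \<in> borel_measurable borel"
    using borel_measurable_chord[of "\<lambda>_. t" borel "\<lambda>x. x"] by simp
  have vim: "chord t -` box l u = T ` box l u"
    by (intro set_eqI iffI) (metis TC image_eqI vimage_eq, metis CT imageE vimageI)
  have "emeasure (distr lborel borel (chord t)) (box l u) = emeasure lborel (T ` box l u)"
    by (subst emeasure_distr) (simp_all add: vim)
  also have "\<dots> = emeasure lebesgue (T ` box l u)"
  proof -
    have "T ` box l u \<in> sets lborel"
      using measurable_sets_borel[OF chord_measurable, of "box l u"] vim by simp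
    then show ?thesis
      by (simp add: sets_completionI_sets main_part_sets)
  qed
  also have "\<dots> = ennreal (measure lebesgue (T ` box l u))"
    by (rule emeasure_eq_measure2[OF measurable_linear_image[OF T lmeasurable_box]])
  also have "measure lebesgue (T ` box l u) = 1 / chord_sq t * measure lebesgue (box l u)"
    using pos by (subst measure_linear_image[OF T]) (simp_all add: detT)
  finally have *: "emeasure (distr lborel borel (chord t)) (box l u)
      = ennreal (1 / chord_sq t * (\<Prod>b\<in>Basis. (u - l) \<bullet> b))"
    using lu by (simp add: measure_lborel_box_eq inner_diff_left)
  have "0 \<le> (\<Prod>b\<in>Basis. (u - l) \<bullet> b)"
    using lu by (intro prod_nonneg) (simp add: inner_diff_left)
  then show "emeasure (density (distr lborel borel (chord t)) (\<lambda>_. ennreal (chord_sq t))) (box l u)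
      = ennreal (\<Prod>b\<in>Basis. (u - l) \<bullet> b)"
    using pos by (simp add: emeasure_density_const * ennreal_mult'[symmetric])
qed simp

lemma nn_integral_chord:
  assumes [measurable]: "f \<in> borel_measurable borel" and t: "chord_sq t \<noteq> 0"
  shows "(\<integral>\<^sup>+x. f (chord t x) \<partial>lborel) = (\<integral>\<^sup>+x. f x \<partial>lborel) / ennreal (chord_sq t)"
proof -
  have pos: "0 < chord_sq t"
    using t chord_sq_nonneg[of t] by simp
  have "(\<integral>\<^sup>+x. f x \<partial>lborel) = ennreal (chord_sq t) * (\<integral>\<^sup>+x. f (chord t x) \<partial>lborel)"
    by (subst lborel_chord[OF t]) (simp add: nn_integral_density nn_integral_distr nn_integral_cmult)
  then show ?thesis
    using pos by (simp add: ennreal_mult_divide_eq mult.commute[of "ennreal (chord_sq t)"])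
qed

text \<open>Jordan's inequality: sine is concave on [0, pi], hence lies above its secant through 0
  and pi / 2.\<close>

lemma sin_ge_linear:
  fixes s :: real
  assumes "0 \<le> s" "s \<le> pi / 2"
  shows "2 * s / pi \<le> sin s"
proof -
  have "convex_on {0..pi} (\<lambda>x. - sin x)"
    by (rule f''_ge0_imp_convex[where f' = "\<lambda>x. - cos x" and f'' = sin])
       (auto intro!: derivative_eq_intros sin_ge_zero)
  from convex_onD[OF this, of "2 * s / pi" 0 "pi / 2"] show ?thesis
    using assms by (simp add: field_simps)
qed

lemma chord_sq_half_angle: "chord_sq t = 4 * (sin (t / 2))\<^sup>2"
  using cos_double_sin[of "t / 2"] by (simp add: chord_sq_def)

text \<open>The quadratic order is what makes 2 the critical exponent: powers -1/p of the Jacobian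
  are controlled by t^(-2/p). The other half of the circle is covered by the symmetry about
  pi.\<close>

lemma chord_sq_ge:
  assumes "0 \<le> t" "t \<le> pi"
  shows "4 / pi\<^sup>2 * t\<^sup>2 \<le> chord_sq t"
proof -
  have "(t / pi)\<^sup>2 \<le> (sin (t / 2))\<^sup>2"
    using sin_ge_linear[of "t / 2"] assms by (intro power_mono) auto
  then show ?thesis
    by (simp add: chord_sq_half_angle power_divide)
qed

lemma chord_sq_reflect: "chord_sq (2 * pi - t) = chord_sq t"
  by (simp add: chord_sq_def)

lemma borel_measurable_chord_sq[measurable]: "chord_sq \<in> borel_measurable borel"
  unfolding chord_sq_def[abs_def] by measurable

lemma chord_sq_gt_0:
  assumes "0 < t" "t < 2 * pi"
  shows "0 < chord_sq t"
proof (cases "t \<le> pi")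
  case True
  have "0 < 4 / pi\<^sup>2 * t\<^sup>2"
    using assms by simp
  then show ?thesis
    using chord_sq_ge[of t] True assms by linarith
next
  case False
  have "0 < 4 / pi\<^sup>2 * (2 * pi - t)\<^sup>2"
    using assms by simp
  also have "\<dots> \<le> chord_sq t"
    using chord_sq_ge[of "2 * pi - t", unfolded chord_sq_reflect] False assms by linarith
  finally show ?thesis .
qed

subsection \<open>Angular parametrisation\<close>

text \<open>A density, rather than a restricted space, keeps the whole line with its Borel sets
  underneath, so that periodic functions can be shifted without leaving the domain. The open
  interval avoids the zeros of \<open>chord_sq\<close>.\<close>

definition angle_measure :: "real measure" where
  "angle_measure = density lborel (indicator {0<..<2 * pi})"

lemma sets_angle_measure[simp, measurable_cong]: "sets angle_measure = sets borel"
  by (simp add: angle_measure_def)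

lemma space_angle_measure[simp]: "space angle_measure = UNIV"
  by (simp add: angle_measure_def)

lemma nn_integral_angle_measure:
  assumes [measurable]: "f \<in> borel_measurable borel"
  shows "(\<integral>\<^sup>+t. f t \<partial>angle_measure) = (\<integral>\<^sup>+t. f t * indicator {0<..<2 * pi} t \<partial>lborel)"
  unfolding angle_measure_def by (subst nn_integral_density) (auto simp: mult.commute)

lemma AE_angle_measure: "AE t in angle_measure. 0 < t \<and> t < 2 * pi"
  unfolding angle_measure_def by (subst AE_density) (auto simp: indicator_def)

interpretation angle: finite_measure angle_measure
  by standard (simp add: angle_measure_def emeasure_density ennreal_indicator)

interpretation lborel_angle: pair_sigma_finite "lborel :: (real^2) measure" angle_measure
  ..

text \<open>Rotation invariance of arc length: the shifted interval is cut at 2 * pi, and the part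
  beyond it is moved back by one period. The cut points are null.\<close>

lemma nn_integral_angle_shift:
  assumes [measurable]: "f \<in> borel_measurable borel" and per: "\<And>t. f (t + 2 * pi) = f t"
    and a: "0 \<le> a" "a \<le> 2 * pi"
  shows "(\<integral>\<^sup>+t. f (t + a) \<partial>angle_measure) = (\<integral>\<^sup>+t. f t \<partial>angle_measure)"
proof -
  have per': "f (2 * pi + t) = f t" for t
    by (metis per add.commute)
  have "(\<integral>\<^sup>+t. f (t + a) \<partial>angle_measure) = (\<integral>\<^sup>+t. f (t + a) * indicator {0<..<2 * pi} t \<partial>lborel)"
    by (subst nn_integral_angle_measure) simp_all
  also have "\<dots> = (\<integral>\<^sup>+t. f t * indicator {a<..<2 * pi + a} t \<partial>lborel)"
    by (subst nn_integral_real_affine[where c = 1 and t = "- a"]) 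
       (auto intro!: nn_integral_cong simp: indicator_def)
  also have "\<dots> = (\<integral>\<^sup>+t. (f t * indicator {a<..<2 * pi} t + f t * indicator {2 * pi<..<2 * pi + a} t) \<partial>lborel)"
  proof (rule nn_integral_cong_AE)
    show "AE t in lborel. f t * indicator {a<..<2 * pi + a} t =
        f t * indicator {a<..<2 * pi} t + f t * indicator {2 * pi<..<2 * pi + a} t"
      using AE_lborel_singleton[of "2 * pi"] by eventually_elim (use a in \<open>auto simp: indicator_def\<close>)
  qed
  also have "\<dots> = (\<integral>\<^sup>+t. f t * indicator {a<..<2 * pi} t \<partial>lborel)
      + (\<integral>\<^sup>+t. f t * indicator {2 * pi<..<2 * pi + a} t \<partial>lborel)"
    by (rule nn_integral_add) simp_all
  also have "(\<integral>\<^sup>+t. f t * indicator {2 * pi<..<2 * pi + a} t \<partial>lborel)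
      = (\<integral>\<^sup>+t. f t * indicator {0<..<a} t \<partial>lborel)"
    by (subst nn_integral_real_affine[where c = 1 and t = "2 * pi"]) 
       (auto intro!: nn_integral_cong simp: indicator_def per')
  also have "(\<integral>\<^sup>+t. f t * indicator {a<..<2 * pi} t \<partial>lborel) + \<dots>
      = (\<integral>\<^sup>+t. (f t * indicator {a<..<2 * pi} t + f t * indicator {0<..<a} t) \<partial>lborel)"
    by (rule nn_integral_add[symmetric]) simp_all
  also have "\<dots> = (\<integral>\<^sup>+t. f t * indicator {0<..<2 * pi} t \<partial>lborel)"
  proof (rule nn_integral_cong_AE)
    show "AE t in lborel. f t * indicator {a<..<2 * pi} t + f t * indicator {0<..<a} t =
        f t * indicator {0<..<2 * pi} t"
      using AE_lborel_singleton[of a] by eventually_elim (use a in \<open>auto simp: indicator_def\<close>)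
  qed
  finally show ?thesis
    by (simp add: nn_integral_angle_measure)
qed

lemma measurable_circle_param:
  "(\<lambda>t. vector [cos t, sin t]) \<in> restrict_space lborel {0..<2 * pi} \<rightarrow>\<^sub>M restrict_space borel (sphere 0 1 :: (real^2) set)"
proof -
  have "(\<lambda>t. rotate_ccw t (vector [1, 0])) \<in> borel_measurable borel"
    by measurable
  then show ?thesis
    by (intro measurable_restrict_space2 measurable_restrict_space1)
       (auto simp: rotate_ccw_def norm_vec_def L2_set_def sum_2)
qed

text \<open>The starting point \<open>n\<close> is left free so that it can be x / |x| for each
  \<open>x\<close> separately; then x - |x| y becomes \<open>chord t x\<close>. Passing from (1, 0)
  to \<open>n\<close> is a shift of the angle.\<close>

lemma nn_integral_circle_measure:
  assumes [measurable]: "f \<in> borel_measurable borel" and n: "norm n = 1"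
  shows "(\<integral>\<^sup>+y. f y \<partial>circle_measure) = (\<integral>\<^sup>+t. f (rotate_ccw t n) \<partial>angle_measure)"
proof -
  obtain a where a: "0 \<le> a" "a < 2 * pi" "n = rotate_ccw a (vector [1, 0])"
    using unit_vector_as_rotation[OF n] .
  define e :: "real \<Rightarrow> real^2" where "e = (\<lambda>t. vector [cos t, sin t])"
  have e: "e = (\<lambda>t. rotate_ccw t (vector [1, 0]))"
    by (simp add: e_def rotate_ccw_def)
  have [measurable]: "e \<in> borel_measurable borel"
    unfolding e by measurable
  have e': "e \<in> restrict_space lborel {0..<2 * pi} \<rightarrow>\<^sub>M restrict_space borel (sphere 0 1)"
    unfolding e_def by (rule measurable_circle_param)
  have f': "f \<in> borel_measurable (restrict_space borel (sphere 0 1))"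
    by (rule measurable_restrict_space1) measurable
  have "(\<integral>\<^sup>+y. f y \<partial>circle_measure) = (\<integral>\<^sup>+t. f (e t) \<partial>restrict_space lborel {0..<2 * pi})"
    unfolding circle_measure_def nn_integral_completion e_def[symmetric]
    by (rule nn_integral_distr[OF e']) (simp add: f')
  also have "\<dots> = (\<integral>\<^sup>+t. f (e t) * indicator {0..<2 * pi} t \<partial>lborel)"
    by (rule nn_integral_restrict_space) simp
  also have "\<dots> = (\<integral>\<^sup>+t. f (e t) * indicator {0<..<2 * pi} t \<partial>lborel)"
  proof (rule nn_integral_cong_AE)
    show "AE t in lborel. f (e t) * indicator {0..<2 * pi} t = f (e t) * indicator {0<..<2 * pi} t"
      using AE_lborel_singleton[of 0] by eventually_elim (auto simp: indicator_def)
  qed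
  also have "\<dots> = (\<integral>\<^sup>+t. f (e t) \<partial>angle_measure)"
    by (simp add: nn_integral_angle_measure)
  also have "\<dots> = (\<integral>\<^sup>+t. f (e (t + a)) \<partial>angle_measure)"
    using a by (subst nn_integral_angle_shift) (simp_all, simp add: e_def)
  finally show ?thesis
    by (simp add: a(3) rotate_ccw_add e)
qed

lemma AE_circle_measure_notin:
  assumes [measurable]: "N \<in> sets borel" and "norm n = 1"
    and null: "(\<integral>\<^sup>+t. indicator N (rotate_ccw t n) \<partial>angle_measure) = 0"
  shows "AE y in circle_measure. y \<notin> N"
proof -
  have "(\<integral>\<^sup>+y. indicator N y \<partial>circle_measure) = 0"
    using nn_integral_circle_measure[of "indicator N" n] assms by simp
  moreover have "indicator N \<in> borel_measurable circle_measure"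
    unfolding circle_measure_def
    by (intro measurable_completion) (simp add: measurable_restrict_space1)
  ultimately have "AE y in circle_measure. (indicator N y :: ennreal) = 0"
    by (subst (asm) nn_integral_0_iff_AE) auto
  then show ?thesis
    by eventually_elim (simp add: indicator_def split: if_splits)
qed

text \<open>Preimages under the two functions differ within a null set, which completeness makes
  harmless. It serves both on the circle, for the integrand, and on the plane, for the
  average.\<close>

lemma (in complete_measure) borel_measurable_cong_AE:
  fixes f g :: "'a \<Rightarrow> 'b :: topological_space"
  assumes f: "f \<in> borel_measurable M" and eq: "AE x in M. f x = g x"
  shows "g \<in> borel_measurable M"
proof (rule measurableI)
  fix A :: "'b set" assume A: "A \<in> sets borel"
  have "AE x in M. x \<in> f -` A \<inter> space M \<longleftrightarrow> x \<in> g -` A \<inter> space M"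
    using eq by eventually_elim simp
  from in_sets_AE[OF this measurable_sets[OF f A]] show "g -` A \<inter> space M \<in> sets M"
    by blast
qed simp

lemma AE_chord_sq_pos: "AE t in angle_measure. 0 < chord_sq t"
  using AE_angle_measure by eventually_elim (simp add: chord_sq_gt_0)

subsection \<open>Reduction to Borel functions\<close>

text \<open>The operator on nonnegative functions, after the substitution \<open>y = rotate_ccw t (x / |x|)\<close>.\<close>

definition bilin_avg ::
    "real \<Rightarrow> (real^2 \<Rightarrow> ennreal) \<Rightarrow> (real^2 \<Rightarrow> ennreal) \<Rightarrow> real^2 \<Rightarrow> ennreal" where
  "bilin_avg \<theta> F G x = (\<integral>\<^sup>+t. F (chord t x) * G (chord (t + \<theta>) x) \<partial>angle_measure)"

lemma borel_measurable_bilin_avg[measurable]: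
  assumes [measurable]: "F \<in> borel_measurable borel" "G \<in> borel_measurable borel"
  shows "bilin_avg \<theta> F G \<in> borel_measurable borel"
  unfolding bilin_avg_def by measurable

lemma chord_as_displacement:
  assumes "x \<noteq> 0"
  shows "x - norm x *\<^sub>R rotate_ccw t ((1 / norm x) *\<^sub>R x) = chord t x"
  using assms by (simp add: chord_def linear_scale[OF linear_rotate_ccw])

text \<open>For each fixed \<open>t\<close> with nonzero Jacobian the preimage of \<open>N\<close>
  under \<open>chord t\<close> is null, so the double integral vanishes when \<open>x\<close> is
  integrated first. Fubini then gives the statement for almost every centre.\<close>

lemma AE_AE_chord_notin:
  assumes N: "N \<in> null_sets lborel"
  shows "AE x in lborel. (\<integral>\<^sup>+t. indicator N (chord t x) \<partial>angle_measure) = 0"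
proof -
  have [measurable]: "N \<in> sets borel"
    using N by auto
  have "(\<integral>\<^sup>+x. \<integral>\<^sup>+t. indicator N (chord t x) \<partial>angle_measure \<partial>lborel)
      = (\<integral>\<^sup>+t. \<integral>\<^sup>+x. indicator N (chord t x) \<partial>lborel \<partial>angle_measure)"
    by (rule lborel_angle.Fubini'[symmetric]) measurable
  also have "\<dots> = (\<integral>\<^sup>+t. 0 \<partial>angle_measure)"
  proof (rule nn_integral_cong_AE)
    show "AE t in angle_measure. (\<integral>\<^sup>+x. indicator N (chord t x) \<partial>lborel) = 0"
      using AE_chord_sq_pos by eventually_elim (use N in \<open>simp add: nn_integral_chord null_setsD1\<close>)
  qed
  finally have "(\<integral>\<^sup>+x. \<integral>\<^sup>+t. indicator N (chord t x) \<partial>angle_measure \<partial>lborel) = 0"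
    by simp
  then show ?thesis
    by (subst (asm) nn_integral_0_iff_AE) auto
qed

lemma circle_points_avoid_null_set:
  assumes N: "N \<in> null_sets lborel" and \<theta>: "0 \<le> \<theta>" "\<theta> \<le> 2 * pi"
  shows "AE x in lborel. x \<noteq> 0 \<and> (AE y in circle_measure.
           x - norm x *\<^sub>R y \<notin> N \<and> x - norm x *\<^sub>R rotate_ccw \<theta> y \<notin> N)"
  using AE_AE_chord_notin[OF N] AE_lborel_singleton[of 0]
proof eventually_elim
  case (elim x)
  have [measurable]: "N \<in> sets borel"
    using N by auto
  define n where "n = (1 / norm x) *\<^sub>R x"
  have n: "norm n = 1"
    using elim by (simp add: n_def)
  have "AE y in circle_measure. y \<notin> {y. x - norm x *\<^sub>R y \<in> N}"
    by (rule AE_circle_measure_notin[OF _ n])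
       (use elim in \<open>simp_all add: n_def indicator_def chord_as_displacement\<close>)
  moreover have "AE y in circle_measure. y \<notin> {y. x - norm x *\<^sub>R rotate_ccw \<theta> y \<in> N}"
  proof (rule AE_circle_measure_notin[OF _ n])
    \<comment> \<open>Rotating \<open>y\<close> by \<theta> adds \<theta> to its angle, and shift
      invariance removes it again, so both factors avoid \<open>N\<close> for the same
      reason.\<close>
    have "(\<integral>\<^sup>+t. indicator {y. x - norm x *\<^sub>R rotate_ccw \<theta> y \<in> N} (rotate_ccw t n) \<partial>angle_measure)
        = (\<integral>\<^sup>+t. indicator N (chord (t + \<theta>) x) \<partial>angle_measure)"
      using elim by (simp add: n_def indicator_def rotate_ccw_add chord_as_displacement add.commute)
    also have "\<dots> = (\<integral>\<^sup>+t. indicator N (chord t x) \<partial>angle_measure)"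
      using \<theta> by (intro nn_integral_angle_shift) (auto simp: chord_periodic)
    finally show "(\<integral>\<^sup>+t. indicator {y. x - norm x *\<^sub>R rotate_ccw \<theta> y \<in> N} (rotate_ccw t n) \<partial>angle_measure) = 0"
      using elim by simp
  qed measurable
  ultimately show ?case
    using elim by auto
qed

interpretation circle: complete_measure circle_measure
  unfolding circle_measure_def by (rule completion.complete_measure_axioms)

text \<open>Measurability in the parameter \<open>x\<close> is a product space argument, for which
  the completion is unsuitable. For Borel integrands the integral against the uncompleted measure
  \<open>M\<close> is the same.\<close>

lemma circ_avg_Borel:
  assumes [measurable]: "f \<in> borel_measurable borel" "g \<in> borel_measurable borel"
  shows "circ_avg \<theta> f g \<in> borel_measurable borel"
    and "circ_integrand \<theta> f g x \<in> borel_measurable circle_measure"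
proof -
  define M :: "(real^2) measure" where
    "M = distr (restrict_space lborel {0..<2 * pi}) (restrict_space borel (sphere 0 1))
       (\<lambda>t. vector [cos t, sin t])"
  have circle: "circle_measure = completion M"
    by (simp add: circle_measure_def M_def)
  have [measurable]: "(\<lambda>y. y) \<in> M \<rightarrow>\<^sub>M borel"
    by (auto simp: M_def intro!: measurable_restrict_space1)
  have "finite_measure (restrict_space lborel {0..<2 * pi})"
    by (intro finite_measureI) (simp add: emeasure_restrict_space)
  then interpret M: finite_measure M
    unfolding M_def by (rule finite_measure.finite_measure_distr[OF _ measurable_circle_param])
  have meas[measurable]: "(\<lambda>y. circ_integrand \<theta> f g x y) \<in> borel_measurable M" for x
    unfolding circ_integrand_def by measurable
  show "circ_integrand \<theta> f g x \<in> borel_measurable circle_measure"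
    unfolding circle by (intro measurable_completion meas)
  have "circ_avg \<theta> f g = (\<lambda>x. LINT y|M. circ_integrand \<theta> f g x y)"
    unfolding circ_avg_def circle by (intro ext integral_completion meas)
  also have "\<dots> \<in> borel_measurable borel"
    unfolding circ_integrand_def by measurable
  finally show "circ_avg \<theta> f g \<in> borel_measurable borel" .
qed

text \<open>For almost every \<open>x\<close> the circle meets the exceptional set of f' and g' only
  in a null set of the circle, so the integrands agree almost everywhere there, and the modulus of
  the new one integrates to exactly \<open>M x\<close>. What remains is to bound
  \<open>bilin_avg\<close> and to show that it is finite almost everywhere.\<close>

lemma circ_avg_reduction:
  assumes \<theta>: "0 \<le> \<theta>" "\<theta> \<le> 2 * pi"
    and [measurable]: "f' \<in> borel_measurable borel" "g' \<in> borel_measurable borel"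
    and f: "AE x in lborel. f x = f' x" and g: "AE x in lborel. g x = g' x"
  defines "M \<equiv> bilin_avg \<theta> (\<lambda>x. ennreal (norm (f' x))) (\<lambda>x. ennreal (norm (g' x)))"
  shows "circ_avg \<theta> f g \<in> borel_measurable lebesgue"
    and "AE x in lborel. ennreal (norm (circ_avg \<theta> f g x)) \<le> M x"
    and "AE x in lborel. M x < \<infinity> \<Longrightarrow> circ_avg_defined \<theta> f g"
proof -
  have "AE x in lborel. f x = f' x \<and> g x = g' x"
    using f g by eventually_elim simp
  then obtain N where N: "N \<in> null_sets lborel" "{x. \<not> (f x = f' x \<and> g x = g' x)} \<subseteq> N"
    unfolding eventually_ae_filter by auto
  have off: "f z = f' z" "g z = g' z" if "z \<notin> N" for z
    using N(2) that by auto
  have M: "(\<integral>\<^sup>+y. ennreal (norm (circ_integrand \<theta> f' g' x y)) \<partial>circle_measure) = M x" if "x \<noteq> 0" for x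
  proof -
    have "norm ((1 / norm x) *\<^sub>R x) = 1"
      using that by simp
    then have "(\<integral>\<^sup>+y. ennreal (norm (circ_integrand \<theta> f' g' x y)) \<partial>circle_measure)
      = (\<integral>\<^sup>+t. ennreal (norm (circ_integrand \<theta> f' g' x (rotate_ccw t ((1 / norm x) *\<^sub>R x)))) \<partial>angle_measure)"
      unfolding circ_integrand_def by (intro nn_integral_circle_measure) measurable
    also have "\<dots> = M x"
      using that
      by (simp add: M_def bilin_avg_def circ_integrand_def chord_as_displacement rotate_ccw_add
          norm_mult ennreal_mult add.commute)
    finally show ?thesis .
  qed
  have good: "AE x in lborel. (integrable circle_measure (circ_integrand \<theta> f g x) \<longleftrightarrow> M x < \<infinity>) \<and>
      circ_avg \<theta> f g x = circ_avg \<theta> f' g' x \<and> ennreal (norm (circ_avg \<theta> f g x)) \<le> M x"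
    using circle_points_avoid_null_set[OF N(1) \<theta>]
  proof eventually_elim
    case (elim x)
    have eq: "AE y in circle_measure. circ_integrand \<theta> f' g' x y = circ_integrand \<theta> f g x y"
      using elim[THEN conjunct2]
    proof eventually_elim
      case (elim y)
      then show ?case
        by (simp add: circ_integrand_def off)
    qed
    have m': "circ_integrand \<theta> f' g' x \<in> borel_measurable circle_measure"
      by (rule circ_avg_Borel) measurable
    have m: "circ_integrand \<theta> f g x \<in> borel_measurable circle_measure"
      by (rule circle.borel_measurable_cong_AE[OF m' eq])
    have avg: "circ_avg \<theta> f g x = circ_avg \<theta> f' g' x"
      unfolding circ_avg_def using eq by (intro integral_cong_AE m m') auto
    have "integrable circle_measure (circ_integrand \<theta> f g x)
        \<longleftrightarrow> integrable circle_measure (circ_integrand \<theta> f' g' x)"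
      using eq by (intro integrable_cong_AE m m') auto
    also have "\<dots> \<longleftrightarrow> M x < \<infinity>"
      using M[of x] elim m' by (simp add: integrable_iff_bounded)
    finally have int: "integrable circle_measure (circ_integrand \<theta> f g x) \<longleftrightarrow> M x < \<infinity>" .
    have "ennreal (norm (circ_avg \<theta> f' g' x)) \<le> M x"
    proof (cases "integrable circle_measure (circ_integrand \<theta> f' g' x)")
      case True
      then show ?thesis
        unfolding circ_avg_def using M[of x] elim integral_norm_bound_ennreal by metis
    next
      \<comment> \<open>Without integrability the Bochner integral is 0, and the bound is
        trivial.\<close>
      case False
      then show ?thesis
        unfolding circ_avg_def by (simp add: not_integrable_integral_eq)
    qed
    with avg int show ?case by simp
  qed
  have "circ_avg \<theta> f' g' \<in> borel_measurable lebesgue"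
    by (intro measurable_completion) (simp add: circ_avg_Borel)
  moreover have "AE x in lebesgue. circ_avg \<theta> f' g' x = circ_avg \<theta> f g x"
    using good by (intro AE_completion) auto
  ultimately show "circ_avg \<theta> f g \<in> borel_measurable lebesgue"
    by (rule complete_measure.borel_measurable_cong_AE[OF completion.complete_measure_axioms])
  show "AE x in lborel. ennreal (norm (circ_avg \<theta> f g x)) \<le> M x"
    using good by eventually_elim blast
  assume "AE x in lborel. M x < \<infinity>"
  with good have "AE x in lborel. integrable circle_measure (circ_integrand \<theta> f g x)"
    by eventually_elim simp
  then show "circ_avg_defined \<theta> f g"
    unfolding circ_avg_defined_def by (rule AE_completion)
qed

subsection \<open>Integrals of the Jacobian\<close>

text \<open>The squared triangle inequality for the points 1, e^(it) and e^(i(t+a)), the last two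
  being at distance |1 - e^(ia)|. With \<open>a\<close> = \<theta>, at every \<open>t\<close> at
  least one of the two Jacobians is at least \<open>chord_sq \<theta> / 4\<close>: the quantitative
  separation of the singularities.\<close>

lemma chord_sq_sum_ge: "chord_sq a \<le> 2 * (chord_sq t + chord_sq (t + a))"
proof -
  have 1: "(1 - cos u)\<^sup>2 + (sin u)\<^sup>2 = chord_sq u" for u
    by (simp add: chord_sq_def power2_eq_square algebra_simps)
  have "chord_sq a = (cos t - cos (t + a))\<^sup>2 + (sin t - sin (t + a))\<^sup>2"
  proof -
    have "cos a = cos t * cos (t + a) + sin t * sin (t + a)"
      using cos_diff[of "t + a" t] by (simp add: mult.commute)
    moreover have "(cos t)\<^sup>2 + (sin t)\<^sup>2 = 1" "(cos (t + a))\<^sup>2 + (sin (t + a))\<^sup>2 = 1"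
      by simp_all
    ultimately show ?thesis
      unfolding chord_sq_def power2_diff by linarith
  qed
  also have "\<dots> \<le> 2 * (((1 - cos t)\<^sup>2 + (sin t)\<^sup>2) + ((1 - cos (t + a))\<^sup>2 + (sin (t + a))\<^sup>2))"
  proof -
    have "(u - v)\<^sup>2 \<le> 2 * (u\<^sup>2 + v\<^sup>2)" for u v :: real
      using zero_le_power2[of "u + v"] by (simp add: power2_sum power2_diff)
    from this[of "1 - cos (t + a)" "1 - cos t"] this[of "sin t" "sin (t + a)"]
    show ?thesis by simp
  qed
  finally show ?thesis
    unfolding 1 .
qed

lemma nn_integral_angle_reflect:
  assumes [measurable]: "f \<in> borel_measurable borel"
  shows "(\<integral>\<^sup>+t. f (2 * pi - t) \<partial>angle_measure) = (\<integral>\<^sup>+t. f t \<partial>angle_measure)"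
proof -
  have "(\<integral>\<^sup>+t. f t * indicator {0<..<2 * pi} t \<partial>lborel)
      = (\<integral>\<^sup>+t. f (2 * pi - t) * indicator {0<..<2 * pi} t \<partial>lborel)"
    by (subst nn_integral_real_affine[where c = "-1" and t = "2 * pi"])
       (auto intro!: nn_integral_cong simp: indicator_def)
  then show ?thesis
    by (simp add: nn_integral_angle_measure)
qed

text \<open>\<open>h\<close> will be a function of the Jacobian, symmetric about pi, while the
  comparison function \<open>f\<close> of \<open>t\<close> is not. On the second half
  \<open>h\<close> is therefore compared with the reflection of \<open>f\<close>, which costs the
  factor 2.\<close>

lemma nn_integral_angle_le_twice:
  assumes [measurable]: "f \<in> borel_measurable borel" "h \<in> borel_measurable borel"
    and le: "\<And>t. 0 < t \<Longrightarrow> t \<le> pi \<Longrightarrow> h t \<le> f t" and sym: "\<And>t. h (2 * pi - t) = h t"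
  shows "(\<integral>\<^sup>+t. h t \<partial>angle_measure) \<le> 2 * (\<integral>\<^sup>+t. f t \<partial>angle_measure)"
proof -
  have "(\<integral>\<^sup>+t. h t \<partial>angle_measure) \<le> (\<integral>\<^sup>+t. f t + f (2 * pi - t) \<partial>angle_measure)"
  proof (rule nn_integral_mono_AE)
    show "AE t in angle_measure. h t \<le> f t + f (2 * pi - t)"
      using AE_angle_measure
    proof eventually_elim
      case (elim t)
      show ?case
      proof (cases "t \<le> pi")
        case True
        with le[of t] elim have "h t \<le> f t" by simp
        then show ?thesis by (rule order.trans) simp
      next
        case False
        with le[of "2 * pi - t"] elim sym[of t] have "h t \<le> f (2 * pi - t)" by simp
        then show ?thesis by (rule order.trans) simp
      qed
    qed
  qed
  also have "\<dots> = 2 * (\<integral>\<^sup>+t. f t \<partial>angle_measure)"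
  proof -
    have "(\<integral>\<^sup>+t. f t + f (2 * pi - t) \<partial>angle_measure)
        = (\<integral>\<^sup>+t. f t \<partial>angle_measure) + (\<integral>\<^sup>+t. f (2 * pi - t) \<partial>angle_measure)"
      by (rule nn_integral_add) measurable
    then show ?thesis
      unfolding nn_integral_angle_reflect[OF assms(1)] by (simp only: mult_2[symmetric])
  qed
  finally show ?thesis .
qed

text \<open>The integrand is at most a multiple of t^(-2a) near 0, and 2a < 1. Here \<open>a\<close>
  is the reciprocal of a Lebesgue exponent above 2.\<close>

lemma nn_integral_chord_sq_powr_finite:
  assumes a: "0 \<le> a" "a < 1 / 2"
  shows "(\<integral>\<^sup>+t. ennreal (chord_sq t powr - a) \<partial>angle_measure) < \<infinity>"
proof -
  define k where "k = (4 / pi\<^sup>2) powr - a"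
  have "(\<integral>\<^sup>+t. ennreal (chord_sq t powr - a) \<partial>angle_measure)
      \<le> 2 * (\<integral>\<^sup>+t. ennreal (k * t powr (- 2 * a)) \<partial>angle_measure)"
  proof (rule nn_integral_angle_le_twice)
    fix t assume t: "0 < t" "t \<le> pi"
    have "chord_sq t powr - a \<le> (4 / pi\<^sup>2 * t\<^sup>2) powr - a"
      using t a by (intro powr_mono2' chord_sq_ge) auto
    also have "\<dots> = k * t powr (- 2 * a)"
      using t by (subst powr_mult) (simp_all add: k_def powr_powr flip: powr_numeral)
    finally show "ennreal (chord_sq t powr - a) \<le> ennreal (k * t powr (- 2 * a))"
      by (rule ennreal_leI)
  qed (simp_all add: chord_sq_reflect)
  also have "(\<integral>\<^sup>+t. ennreal (k * t powr (- 2 * a)) \<partial>angle_measure)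
      \<le> (\<integral>\<^sup>+t. ennreal k * (ennreal (t powr (- 2 * a)) * indicator {0..2 * pi} t) \<partial>lborel)"
    by (subst nn_integral_angle_measure) (auto intro!: nn_integral_mono simp: indicator_def k_def ennreal_mult)
  also have "\<dots> = ennreal k * (\<integral>\<^sup>+t. ennreal (t powr (- 2 * a)) * indicator {0..2 * pi} t \<partial>lborel)"
    by (rule nn_integral_cmult) measurable
  also have "(\<integral>\<^sup>+t. ennreal (t powr (- 2 * a)) * indicator {0..2 * pi} t \<partial>lborel)
      = ennreal ((2 * pi) powr (- 2 * a + 1) / (- 2 * a + 1))"
    using a by (intro nn_integral_has_integral_lebesgue' has_integral_powr_from_0) auto
  finally show ?thesis
    by (auto simp: ennreal_mult_less_top mult_left_mono less_top[symmetric] top_unique ennreal_mult_eq_top_iff)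
qed

lemma nn_integral_min_inverse_square:
  assumes "0 < A" "0 < (b::real)"
  shows "(\<integral>\<^sup>+t. ennreal (min (A / t\<^sup>2) b) \<partial>angle_measure) \<le> ennreal (2 * sqrt (A * b))"
proof -
  \<comment> \<open>The two entries of the minimum cross at \<open>c\<close>. Using \<open>b\<close>
    below and A / t^2 above, each side contributes sqrt (A * b).\<close>
  define c where "c = sqrt (A / b)"
  have c: "0 < c" using assms by (simp add: c_def)
  have "(\<integral>\<^sup>+t. ennreal (min (A / t\<^sup>2) b) \<partial>angle_measure)
      \<le> (\<integral>\<^sup>+t. ennreal b * indicator {0<..<c} t + ennreal A * (ennreal (t powr -2) * indicator {c..} t) \<partial>lborel)"
    using assms c
    by (subst nn_integral_angle_measure)
       (auto intro!: nn_integral_mono simp: indicator_def powr_minus divide_inverse ennreal_mult[symmetric]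
          intro!: ennreal_leI)
  also have "\<dots> = ennreal b * (\<integral>\<^sup>+t. indicator {0<..<c} t \<partial>lborel)
      + ennreal A * (\<integral>\<^sup>+t. ennreal (t powr -2) * indicator {c..} t \<partial>lborel)"
    by (subst nn_integral_add) (simp_all add: nn_integral_cmult)
  also have "(\<integral>\<^sup>+t. ennreal (t powr -2) * indicator {c..} t \<partial>lborel) = ennreal (1 / c)"
    using has_integral_powr_to_inf[of "-2" c] c
    by (intro nn_integral_has_integral_lebesgue') (auto simp: powr_minus divide_inverse)
  also have "ennreal b * (\<integral>\<^sup>+t. indicator {0<..<c} t \<partial>lborel) + ennreal A * ennreal (1 / c) = ennreal (b * c + A / c)"
    using assms c by (simp add: ennreal_mult[symmetric])
  also have "b * c + A / c = 2 * sqrt (A * b)"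
  proof -
    have "b * c = sqrt (b\<^sup>2 * (A / b))" "A / c = sqrt (A\<^sup>2 * (b / A))"
      using assms by (simp_all add: c_def real_sqrt_mult real_sqrt_divide field_simps)
    then show ?thesis
      using assms by (simp add: power2_eq_square mult.commute)
  qed
  finally show ?thesis .
qed

text \<open>The arguments are extended reals because measures of superlevel sets may be infinite;
  the degenerate cases come first. The constant is 2 (reflection) times 2 (integral of the minimum)
  times pi / 2 (from comparing the Jacobian with t^2).\<close>

lemma nn_integral_min_chord_sq:
  "(\<integral>\<^sup>+t. min (a / ennreal (chord_sq t)) b \<partial>angle_measure)
    \<le> ennreal (2 * pi) * epowr a (1 / 2) * epowr b (1 / 2)"
proof -
  consider "a = 0 \<or> b = 0" | "a \<noteq> 0" "b \<noteq> 0" "a = \<infinity> \<or> b = \<infinity>" |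
    a' b' where "a = ennreal a'" "b = ennreal b'" "0 < a'" "0 < b'"
    by (cases a; cases b) (auto simp: less_le)
  then show ?thesis
  proof cases
    case 1
    then have "min (a / ennreal (chord_sq t)) b = 0" for t
      by (auto simp: min_def)
    then show ?thesis by simp
  next
    case 2
    then have "epowr a (1 / 2) * epowr b (1 / 2) = \<infinity>"
      by (cases a; cases b) (auto simp: epowr_def ennreal_mult_eq_top_iff)
    then have "ennreal (2 * pi) * epowr a (1 / 2) * epowr b (1 / 2) = \<infinity>"
      by (simp only: mult.assoc) (simp add: ennreal_mult_eq_top_iff)
    then show ?thesis
      by (simp only: infinity_ennreal_def top_greatest)
  next
    case 3
    define A where "A = a' * pi\<^sup>2 / 4"
    have A: "0 < A" using 3 by (simp add: A_def)
    have "(\<integral>\<^sup>+t. min (a / ennreal (chord_sq t)) b \<partial>angle_measure)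
      \<le> (\<integral>\<^sup>+t. ennreal (min (a' / chord_sq t) b') \<partial>angle_measure)"
    proof (rule nn_integral_mono_AE)
      show "AE t in angle_measure. min (a / ennreal (chord_sq t)) b \<le> ennreal (min (a' / chord_sq t) b')"
        using AE_chord_sq_pos by eventually_elim (use 3 in \<open>simp add: divide_ennreal min_def\<close>)
    qed
    also have "\<dots> \<le> 2 * (\<integral>\<^sup>+t. ennreal (min (A / t\<^sup>2) b') \<partial>angle_measure)"
    proof (rule nn_integral_angle_le_twice)
      fix t assume t: "0 < t" "t \<le> pi"
      have "a' / chord_sq t \<le> a' / (4 / pi\<^sup>2 * t\<^sup>2)"
        using t 3 chord_sq_ge[of t] chord_sq_gt_0[of t]
        by (intro divide_left_mono mult_pos_pos) auto
      also have "\<dots> = A / t\<^sup>2"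
        by (simp add: A_def)
      finally show "ennreal (min (a' / chord_sq t) b') \<le> ennreal (min (A / t\<^sup>2) b')"
        by (intro ennreal_leI) auto
    qed (simp_all add: chord_sq_reflect)
    also have "\<dots> \<le> 2 * ennreal (2 * sqrt (A * b'))"
      using A 3 by (intro mult_left_mono nn_integral_min_inverse_square) auto
    also have "\<dots> = ennreal (4 * sqrt (A * b'))"
      using A 3 by (simp flip: ennreal_numeral add: ennreal_mult[symmetric])
    also have "4 * sqrt (A * b') = 2 * pi * sqrt a' * sqrt b'"
      by (simp add: A_def real_sqrt_mult real_sqrt_divide)
    also have "ennreal \<dots> = ennreal (2 * pi) * epowr a (1 / 2) * epowr b (1 / 2)"
      using 3 by (simp add: epowr_def powr_half_sqrt ennreal_mult)
    finally show ?thesis .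
  qed
qed

lemma nn_integral_min_chord_sq_shift:
  assumes "0 \<le> \<theta>" "\<theta> \<le> 2 * pi"
  shows "(\<integral>\<^sup>+t. min (a / ennreal (chord_sq (t + \<theta>))) b \<partial>angle_measure)
    \<le> ennreal (2 * pi) * epowr a (1 / 2) * epowr b (1 / 2)"
  using nn_integral_angle_shift[of "\<lambda>t. min (a / ennreal (chord_sq t)) b" \<theta>] assms
    nn_integral_min_chord_sq[of a b] by (simp add: chord_sq_periodic)

lemma min_mult_right_le:
  fixes x y k :: ennreal
  assumes "1 \<le> k"
  shows "min x (k * y) \<le> k * min x y"
proof (cases "x \<le> y")
  case True
  have "min x (k * y) \<le> 1 * x" by simp
  also have "\<dots> \<le> k * x" using assms by (rule mult_right_mono) simp
  finally show ?thesis using True by (simp add: min_def)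
next
  case False
  then show ?thesis by (simp add: min_def)
qed

text \<open>At each \<open>t\<close> one Jacobian is bounded below, so its quotient may be replaced
  by a multiple of its numerator. What is left is a minimum with a single singularity, treated
  above.\<close>

lemma nn_integral_min_two_chord_sq:
  assumes "0 < \<theta>" "\<theta> < 2 * pi"
  obtains K where "0 < K" "\<And>a b. (\<integral>\<^sup>+t. min (a / ennreal (chord_sq t)) (b / ennreal (chord_sq (t + \<theta>))) \<partial>angle_measure)
    \<le> ennreal K * epowr a (1 / 2) * epowr b (1 / 2)"
proof
  \<comment> \<open>The second entry bounds the reciprocal of the larger Jacobian; the lower bound 1
    allows \<open>k\<close> to be pulled out of a minimum in which it multiplies only one
    entry.\<close>
  define k where "k = max 1 (4 / chord_sq \<theta>)"
  have k: "1 \<le> k" by (simp add: k_def)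
  have c: "0 < chord_sq \<theta>" using assms by (rule chord_sq_gt_0)
  show "0 < 4 * pi * k" using k by simp
  have far: "a / ennreal s \<le> ennreal k * a" if "chord_sq \<theta> / 4 \<le> s" for a s
  proof -
    have "1 / s \<le> 4 / chord_sq \<theta>"
      using that c by (simp add: field_simps)
    then have "1 / s \<le> k"
      by (simp add: k_def)
    moreover have "0 < s" using that c by linarith
    ultimately have "1 / ennreal s \<le> ennreal k"
      by (simp add: divide_ennreal ennreal_leI flip: ennreal_1)
    then have "a * (1 / ennreal s) \<le> a * ennreal k"
      by (rule mult_left_mono) simp
    then show ?thesis
      by (simp add: ennreal_times_divide mult.commute)
  qed
  fix a b :: ennreal
  have "(\<integral>\<^sup>+t. min (a / ennreal (chord_sq t)) (b / ennreal (chord_sq (t + \<theta>))) \<partial>angle_measure)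
    \<le> (\<integral>\<^sup>+t. ennreal k * (min (a / ennreal (chord_sq t)) b
                       + min (b / ennreal (chord_sq (t + \<theta>))) a) \<partial>angle_measure)"
  proof (rule nn_integral_mono)
    fix t
    have sum: "chord_sq \<theta> \<le> 2 * (chord_sq t + chord_sq (t + \<theta>))"
      by (rule chord_sq_sum_ge)
    let ?m1 = "min (a / ennreal (chord_sq t)) b" and ?m2 = "min (b / ennreal (chord_sq (t + \<theta>))) a"
    have "chord_sq \<theta> / 4 \<le> chord_sq t \<or> chord_sq \<theta> / 4 \<le> chord_sq (t + \<theta>)"
      using sum by argo
    then have "min (a / ennreal (chord_sq t)) (b / ennreal (chord_sq (t + \<theta>))) \<le> ennreal k * ?m1
      \<or> min (a / ennreal (chord_sq t)) (b / ennreal (chord_sq (t + \<theta>))) \<le> ennreal k * ?m2"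
    proof (elim disjE)
      assume 1: "chord_sq \<theta> / 4 \<le> chord_sq t"
      have "min (a / ennreal (chord_sq t)) (b / ennreal (chord_sq (t + \<theta>)))
          \<le> min (b / ennreal (chord_sq (t + \<theta>))) (ennreal k * a)"
        using far[OF 1, of a] by (simp add: min.coboundedI1)
      also have "\<dots> \<le> ennreal k * ?m2"
        using k by (intro min_mult_right_le) simp
      finally show ?thesis ..
    next
      assume 2: "chord_sq \<theta> / 4 \<le> chord_sq (t + \<theta>)"
      have "min (a / ennreal (chord_sq t)) (b / ennreal (chord_sq (t + \<theta>)))
          \<le> min (a / ennreal (chord_sq t)) (ennreal k * b)"
        using far[OF 2, of b] by (simp add: min.coboundedI2)
      also have "\<dots> \<le> ennreal k * ?m1"
        using k by (intro min_mult_right_le) simp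
      finally show ?thesis ..
    qed
    then show "min (a / ennreal (chord_sq t)) (b / ennreal (chord_sq (t + \<theta>))) \<le> ennreal k * (?m1 + ?m2)"
      unfolding distrib_left by (elim disjE) (erule order.trans, simp)+
  qed
  also have "\<dots> = ennreal k * ((\<integral>\<^sup>+t. min (a / ennreal (chord_sq t)) b \<partial>angle_measure)
       + (\<integral>\<^sup>+t. min (b / ennreal (chord_sq (t + \<theta>))) a \<partial>angle_measure))"
    by (subst nn_integral_cmult, measurable, subst nn_integral_add) simp_all
  also have "\<dots> \<le> ennreal k * (ennreal (2 * pi) * epowr a (1 / 2) * epowr b (1 / 2)
      + ennreal (2 * pi) * epowr b (1 / 2) * epowr a (1 / 2))"
    using assms by (intro mult_left_mono add_mono nn_integral_min_chord_sq nn_integral_min_chord_sq_shift) auto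
  also have "\<dots> = (ennreal k * (ennreal (2 * pi) + ennreal (2 * pi))) * epowr a (1 / 2) * epowr b (1 / 2)"
    by (simp only: distrib_left distrib_right mult.assoc mult.commute[of "epowr b (1 / 2)" "epowr a (1 / 2)"])
  also have "ennreal k * (ennreal (2 * pi) + ennreal (2 * pi)) = ennreal (4 * pi * k)"
  proof -
    have "ennreal (2 * pi) + ennreal (2 * pi) = ennreal (4 * pi)"
      by (subst ennreal_plus[symmetric]) simp_all
    then show ?thesis
      using k by (simp add: mult.commute[of "ennreal k"] ennreal_mult)
  qed
  finally show "(\<integral>\<^sup>+t. min (a / ennreal (chord_sq t)) (b / ennreal (chord_sq (t + \<theta>))) \<partial>angle_measure)
    \<le> ennreal (4 * pi * k) * epowr a (1 / 2) * epowr b (1 / 2)" .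
qed

section \<open>Interpolation between two bounds\<close>

lemma epowr_ennreal: "0 \<le> x \<Longrightarrow> epowr (ennreal x) r = ennreal (x powr r)"
  by (simp add: epowr_def)

text \<open>The weighted geometric mean of the two bounds with weights 2r and 1 - 2r, which sum to 1
  and so leave the common factor \<open>X\<close> unchanged. In the application \<open>X\<close>
  carries the constant and the square root of the measure belonging to the first function.\<close>

lemma epowr_interpolate:
  assumes 1: "T \<le> X * epowr f (1 / 2)" and 2: "T \<le> X * ennreal (b powr (1 / 2))"
    and r: "0 < r" "r \<le> 1 / 2" and b: "0 < b"
  shows "T \<le> X * epowr f r * ennreal (b powr (1 / 2 - r))"
proof -
  consider "f = 0" | "X = 0" | "f \<noteq> 0" "X \<noteq> 0" "f = \<infinity> \<or> X = \<infinity>" |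
    f' x where "f = ennreal f'" "X = ennreal x" "0 < f'" "0 < x"
    by (cases f; cases X) (auto simp: less_le)
  then show ?thesis
  proof cases
    case 1
    then show ?thesis using assms(1) r by (simp add: epowr_def)
  next
    case 2
    then show ?thesis using assms(1) by simp
  next
    case 3
    then have "X * epowr f r * ennreal (b powr (1 / 2 - r)) = \<infinity>"
      using b by (cases f; cases X) (auto simp: epowr_def ennreal_mult_eq_top_iff)
    then show ?thesis
      by (simp only: infinity_ennreal_def top_greatest)
  next
    case 4
    define A where "A = x * f' powr (1 / 2)"
    define B where "B = x * b powr (1 / 2)"
    have AB: "0 < A" "0 < B" using 4 b by (simp_all add: A_def B_def)
    have "T \<le> ennreal A" "T \<le> ennreal B"
      using 1 2 4 by (simp_all add: A_def B_def epowr_ennreal ennreal_mult)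
    then have T: "T \<le> ennreal (min A B)"
      by (simp add: min_def)
    have "min A B = min A B powr (2 * r) * min A B powr (1 - 2 * r)"
      using AB by (simp add: powr_add[symmetric])
    also have "\<dots> \<le> A powr (2 * r) * B powr (1 - 2 * r)"
      using AB r by (intro mult_mono powr_mono2) auto
    also have "\<dots> = x * f' powr r * b powr (1 / 2 - r)"
    proof -
      have "A powr (2 * r) = x powr (2 * r) * f' powr r"
        using 4 by (simp add: A_def powr_mult powr_powr)
      moreover have "B powr (1 - 2 * r) = x powr (1 - 2 * r) * b powr (1 / 2 - r)"
        using 4 b by (simp add: B_def powr_mult powr_powr diff_divide_distrib)
      ultimately have "A powr (2 * r) * B powr (1 - 2 * r)
          = (x powr (2 * r) * x powr (1 - 2 * r)) * f' powr r * b powr (1 / 2 - r)"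
        by (simp only: mult_ac)
      also have "x powr (2 * r) * x powr (1 - 2 * r) = x"
        using 4 by (simp add: powr_add[symmetric])
      finally show ?thesis .
    qed
    finally have "ennreal (min A B) \<le> ennreal (x * f' powr r * b powr (1 / 2 - r))"
      by (rule ennreal_leI)
    with T show ?thesis
      using 4 by (simp add: epowr_ennreal ennreal_mult)
  qed
qed

subsection \<open>Layer cake decomposition\<close>

interpretation angle_lborel: pair_sigma_finite angle_measure "lborel :: real measure"
  ..

lemma AE_chord_sq_shift_pos:
  assumes "0 \<le> \<theta>" "\<theta> \<le> 2 * pi"
  shows "AE t in angle_measure. 0 < chord_sq (t + \<theta>)"
proof -
  have [measurable]: "{t. \<not> 0 < chord_sq t} \<in> sets borel"
    by measurable
  have "(\<integral>\<^sup>+t. indicator {t. \<not> 0 < chord_sq t} (t + \<theta>) \<partial>angle_measure)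
      = (\<integral>\<^sup>+t. indicator {t. \<not> 0 < chord_sq t} t \<partial>angle_measure)"
    using assms by (intro nn_integral_angle_shift) (simp_all add: chord_sq_periodic indicator_def)
  also have "\<dots> = (\<integral>\<^sup>+t. 0 \<partial>angle_measure)"
  proof (rule nn_integral_cong_AE)
    show "AE t in angle_measure. indicator {t. \<not> 0 < chord_sq t} t = (0 :: ennreal)"
      using AE_chord_sq_pos by eventually_elim simp
  qed
  finally have "(\<integral>\<^sup>+t. indicator {t. \<not> 0 < chord_sq t} (t + \<theta>) \<partial>angle_measure) = 0"
    by simp
  then have "AE t in angle_measure. (indicator {t. \<not> 0 < chord_sq t} (t + \<theta>) :: ennreal) = 0"
    by (subst (asm) nn_integral_0_iff_AE) auto
  then show ?thesis
    by eventually_elim (auto simp: indicator_def split: if_splits)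
qed

text \<open>After Fubini, the inner integral at fixed \<open>t\<close> is the measure of the
  intersection of \<open>B\<close> with the preimages of \<open>E\<close> and \<open>F\<close> under
  two chord maps, hence at most each of the three measures.\<close>

lemma bilin_avg_indicator_le:
  assumes [measurable]: "E \<in> sets borel" "F \<in> sets borel" "B \<in> sets borel"
    and \<theta>: "0 \<le> \<theta>" "\<theta> \<le> 2 * pi"
  shows "(\<integral>\<^sup>+x. indicator B x * bilin_avg \<theta> (indicator E) (indicator F) x \<partial>lborel)
    \<le> (\<integral>\<^sup>+t. min (min (emeasure lborel E / ennreal (chord_sq t))
                  (emeasure lborel F / ennreal (chord_sq (t + \<theta>)))) (emeasure lborel B) \<partial>angle_measure)"
proof -
  let ?J = "\<lambda>x t. indicator B x * (indicator E (chord t x) * indicator F (chord (t + \<theta>) x)) :: ennreal"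
  have "(\<integral>\<^sup>+x. indicator B x * bilin_avg \<theta> (indicator E) (indicator F) x \<partial>lborel)
      = (\<integral>\<^sup>+x. \<integral>\<^sup>+t. ?J x t \<partial>angle_measure \<partial>lborel)"
    unfolding bilin_avg_def by (intro nn_integral_cong nn_integral_cmult[symmetric]) measurable
  also have "\<dots> = (\<integral>\<^sup>+t. \<integral>\<^sup>+x. ?J x t \<partial>lborel \<partial>angle_measure)"
    by (rule lborel_angle.Fubini'[symmetric]) measurable
  also have "\<dots> \<le> (\<integral>\<^sup>+t. min (min (emeasure lborel E / ennreal (chord_sq t))
      (emeasure lborel F / ennreal (chord_sq (t + \<theta>)))) (emeasure lborel B) \<partial>angle_measure)"
  proof (rule nn_integral_mono_AE)
    have m: "(\<integral>\<^sup>+x. indicator A (chord t x) \<partial>lborel) = emeasure lborel A / ennreal (chord_sq t)"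
      if "0 < chord_sq t" "A \<in> sets borel" for t A
      using that by (subst nn_integral_chord) auto
    show "AE t in angle_measure. (\<integral>\<^sup>+x. ?J x t \<partial>lborel)
        \<le> min (min (emeasure lborel E / ennreal (chord_sq t))
            (emeasure lborel F / ennreal (chord_sq (t + \<theta>)))) (emeasure lborel B)"
      using AE_chord_sq_pos AE_chord_sq_shift_pos[OF \<theta>]
    proof eventually_elim
      case (elim t)
      have "(\<integral>\<^sup>+x. ?J x t \<partial>lborel) \<le> (\<integral>\<^sup>+x. indicator E (chord t x) \<partial>lborel)"
        by (intro nn_integral_mono) (auto simp: indicator_def)
      moreover have "(\<integral>\<^sup>+x. ?J x t \<partial>lborel) \<le> (\<integral>\<^sup>+x. indicator F (chord (t + \<theta>) x) \<partial>lborel)"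
        by (intro nn_integral_mono) (auto simp: indicator_def)
      moreover have "(\<integral>\<^sup>+x. ?J x t \<partial>lborel) \<le> (\<integral>\<^sup>+x. indicator B x \<partial>lborel)"
        by (intro nn_integral_mono) (auto simp: indicator_def)
      ultimately show ?case
        using elim by (simp add: m)
    qed
  qed
  finally show ?thesis .
qed

lemma layer_cake:
  fixes a :: real
  assumes "0 \<le> a"
  shows "ennreal a = (\<integral>\<^sup>+s. indicator {0..} s * indicator {s. s < a} s \<partial>lborel)"
proof -
  have "(\<integral>\<^sup>+s. indicator {0..} s * indicator {s. s < a} s \<partial>lborel) = (\<integral>\<^sup>+s. indicator {0..<a} s \<partial>lborel)"
    by (intro nn_integral_cong) (auto simp: indicator_def)
  also have "\<dots> = ennreal a"
    using assms by simp
  finally show ?thesis ..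
qed

lemma bilin_avg_layer_cake_left:
  assumes [measurable]: "F \<in> borel_measurable borel" "H \<in> borel_measurable borel" and "\<And>x. 0 \<le> F x"
  shows "bilin_avg \<theta> (\<lambda>x. ennreal (F x)) H x
    = (\<integral>\<^sup>+s. indicator {0..} s * bilin_avg \<theta> (indicator {y. s < F y}) H x \<partial>lborel)"
proof -
  have "bilin_avg \<theta> (\<lambda>x. ennreal (F x)) H x = (\<integral>\<^sup>+t. (\<integral>\<^sup>+s. indicator {0..} s * indicator {s. s < F (chord t x)} s \<partial>lborel)
      * H (chord (t + \<theta>) x) \<partial>angle_measure)"
    unfolding bilin_avg_def using assms(3) by (intro nn_integral_cong) (simp add: layer_cake)
  also have "\<dots> = (\<integral>\<^sup>+t. \<integral>\<^sup>+s. indicator {0..} s * (indicator {y. s < F y} (chord t x)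
      * H (chord (t + \<theta>) x)) \<partial>lborel \<partial>angle_measure)"
    by (subst nn_integral_multc[symmetric]) (auto simp: indicator_def mult.assoc intro!: nn_integral_cong)
  also have "\<dots> = (\<integral>\<^sup>+s. \<integral>\<^sup>+t. indicator {0..} s * (indicator {y. s < F y} (chord t x)
      * H (chord (t + \<theta>) x)) \<partial>angle_measure \<partial>lborel)"
    by (rule angle_lborel.Fubini'[symmetric]) measurable
  also have "\<dots> = (\<integral>\<^sup>+s. indicator {0..} s * bilin_avg \<theta> (indicator {y. s < F y}) H x \<partial>lborel)"
    unfolding bilin_avg_def by (intro nn_integral_cong nn_integral_cmult) measurable
  finally show ?thesis .
qed

text \<open>Shifting the angle by \<theta> exchanges the roles of the two functions, with 2 * pi -
  \<theta> in place of \<theta>, which again lies between 0 and 2 * pi. Every one-sided result below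
  is transferred to the other argument in this way.\<close>

lemma bilin_avg_swap:
  assumes [measurable]: "F \<in> borel_measurable borel" "G \<in> borel_measurable borel"
    and "0 \<le> \<theta>" "\<theta> \<le> 2 * pi"
  shows "bilin_avg \<theta> F G = bilin_avg (2 * pi - \<theta>) G F"
proof
  fix x
  have "(\<integral>\<^sup>+t. G (chord (t + \<theta>) x) * F (chord (t + \<theta> + (2 * pi - \<theta>)) x) \<partial>angle_measure)
      = (\<integral>\<^sup>+t. G (chord t x) * F (chord (t + (2 * pi - \<theta>)) x) \<partial>angle_measure)"
  proof (rule nn_integral_angle_shift)
    fix t
    have "t + 2 * pi + (2 * pi - \<theta>) = t + (2 * pi - \<theta>) + 2 * pi"
      by simp
    then show "G (chord (t + 2 * pi) x) * F (chord (t + 2 * pi + (2 * pi - \<theta>)) x)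
        = G (chord t x) * F (chord (t + (2 * pi - \<theta>)) x)"
      by (simp only: chord_periodic)
  qed (use assms in \<open>simp_all, measurable\<close>)
  moreover have "F (chord t x) * G (chord (t + \<theta>) x)
      = G (chord (t + \<theta>) x) * F (chord (t + \<theta> + (2 * pi - \<theta>)) x)" for t
  proof -
    have "t + \<theta> + (2 * pi - \<theta>) = t + 2 * pi"
      by simp
    then show ?thesis
      by (simp only: chord_periodic mult.commute[of "F (chord t x)"])
  qed
  ultimately show "bilin_avg \<theta> F G x = bilin_avg (2 * pi - \<theta>) G F x"
    unfolding bilin_avg_def by (simp only:)
qed

lemma integral_bilin_avg_layer_cake_left:
  assumes [measurable]: "F \<in> borel_measurable borel" "H \<in> borel_measurable borel" "B \<in> sets borel"
    and "\<And>x. 0 \<le> F x"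
  shows "(\<integral>\<^sup>+x. indicator B x * bilin_avg \<theta> (\<lambda>x. ennreal (F x)) H x \<partial>lborel)
    = (\<integral>\<^sup>+s. indicator {0..} s *
         (\<integral>\<^sup>+x. indicator B x * bilin_avg \<theta> (indicator {y. s < F y}) H x \<partial>lborel) \<partial>lborel)"
proof -
  have [measurable]: "(\<lambda>(x, s). bilin_avg \<theta> (indicator {y. s < F y}) H x) \<in> borel_measurable (borel \<Otimes>\<^sub>M borel)"
    unfolding bilin_avg_def by measurable
  have "(\<integral>\<^sup>+x. indicator B x * bilin_avg \<theta> (\<lambda>x. ennreal (F x)) H x \<partial>lborel)
      = (\<integral>\<^sup>+x. \<integral>\<^sup>+s. indicator {0..} s * (indicator B x * bilin_avg \<theta> (indicator {y. s < F y}) H x) \<partial>lborel \<partial>lborel)"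
    using assms(4)
    by (subst bilin_avg_layer_cake_left) (auto simp: nn_integral_cmult[symmetric] mult.left_commute)
  also have "\<dots> = (\<integral>\<^sup>+s. \<integral>\<^sup>+x. indicator {0..} s * (indicator B x * bilin_avg \<theta> (indicator {y. s < F y}) H x) \<partial>lborel \<partial>lborel)"
    by (rule lborel_pair.Fubini'[symmetric]) measurable
  also have "\<dots> = (\<integral>\<^sup>+s. indicator {0..} s *
      (\<integral>\<^sup>+x. indicator B x * bilin_avg \<theta> (indicator {y. s < F y}) H x \<partial>lborel) \<partial>lborel)"
    by (intro nn_integral_cong nn_integral_cmult) measurable
  finally show ?thesis .
qed

lemma integral_bilin_avg_le_superlevel:
  assumes F[measurable]: "F \<in> borel_measurable borel" "\<And>x. 0 \<le> F x"
    and G[measurable]: "G \<in> borel_measurable borel" "\<And>x. 0 \<le> G x"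
    and [measurable]: "B \<in> sets borel" and \<theta>: "0 \<le> \<theta>" "\<theta> \<le> 2 * pi"
  shows "(\<integral>\<^sup>+x. indicator B x * bilin_avg \<theta> (\<lambda>x. ennreal (F x)) (\<lambda>x. ennreal (G x)) x \<partial>lborel)
    \<le> (\<integral>\<^sup>+s. indicator {0..} s * (\<integral>\<^sup>+s'. indicator {0..} s' * (\<integral>\<^sup>+t.
          min (min (emeasure lborel {y. s < F y} / ennreal (chord_sq t))
            (emeasure lborel {y. s' < G y} / ennreal (chord_sq (t + \<theta>)))) (emeasure lborel B)
          \<partial>angle_measure) \<partial>lborel) \<partial>lborel)"
proof -
  have "(\<integral>\<^sup>+x. indicator B x * bilin_avg \<theta> (indicator {y. s < F y}) (\<lambda>x. ennreal (G x)) x \<partial>lborel)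
      = (\<integral>\<^sup>+s'. indicator {0..} s' *
         (\<integral>\<^sup>+x. indicator B x * bilin_avg \<theta> (indicator {y. s < F y}) (indicator {y. s' < G y}) x \<partial>lborel) \<partial>lborel)" for s
  proof -
    \<comment> \<open>The layer cake formula is available for the first argument only, so
      \<open>G\<close> is moved there and back.\<close>
    have swap: "bilin_avg \<theta> (indicator {y. s < F y}) H = bilin_avg (2 * pi - \<theta>) H (indicator {y. s < F y})"
      if "H \<in> borel_measurable borel" for H
      using that \<theta> by (intro bilin_avg_swap) auto
    show ?thesis
      using integral_bilin_avg_layer_cake_left[of G "indicator {y. s < F y}" B "2 * pi - \<theta>"] G(2)
      by (simp add: swap)
  qed
  then have "(\<integral>\<^sup>+x. indicator B x * bilin_avg \<theta> (\<lambda>x. ennreal (F x)) (\<lambda>x. ennreal (G x)) x \<partial>lborel)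
      = (\<integral>\<^sup>+s. indicator {0..} s * (\<integral>\<^sup>+s'. indicator {0..} s' *
         (\<integral>\<^sup>+x. indicator B x * bilin_avg \<theta> (indicator {y. s < F y}) (indicator {y. s' < G y}) x \<partial>lborel) \<partial>lborel) \<partial>lborel)"
    by (subst integral_bilin_avg_layer_cake_left) (simp_all add: F(2))
  also have "\<dots> \<le> (\<integral>\<^sup>+s. indicator {0..} s * (\<integral>\<^sup>+s'. indicator {0..} s' * (\<integral>\<^sup>+t.
          min (min (emeasure lborel {y. s < F y} / ennreal (chord_sq t))
            (emeasure lborel {y. s' < G y} / ennreal (chord_sq (t + \<theta>)))) (emeasure lborel B)
          \<partial>angle_measure) \<partial>lborel) \<partial>lborel)"
    using \<theta> by (intro nn_integral_mono mult_left_mono bilin_avg_indicator_le) auto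
  finally show ?thesis .
qed

lemma borel_measurable_superlevel[measurable]:
  fixes F :: "real^2 \<Rightarrow> real"
  assumes [measurable]: "F \<in> borel_measurable borel"
  shows "(\<lambda>s. emeasure lborel {y. s < F y}) \<in> borel_measurable borel"
proof -
  have "(\<lambda>s. \<integral>\<^sup>+y. indicator {y. s < F y} y \<partial>lborel) \<in> borel_measurable borel"
    by measurable
  then show ?thesis
    by simp
qed

lemma borel_measurable_epowr[measurable (raw)]:
  assumes [measurable]: "f \<in> borel_measurable M"
  shows "(\<lambda>x. epowr (f x) r) \<in> borel_measurable M"
  unfolding epowr_def by measurable

text \<open>
  The two cases cover the exponents \<open>p\<^sub>2 = 1 / r < \<infinity>\<close> and \<open>p\<^sub>2 = \<infinity>\<close>, the latter with \<open>G\<close> bounded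
  by \<open>c\<close>.
\<close>

definition superlevel_weight :: "(real^2 \<Rightarrow> real) \<Rightarrow> real \<Rightarrow> real \<Rightarrow> real \<Rightarrow> ennreal" where
  "superlevel_weight G c r s =
     (if r = 0 then indicator {..<c} s else epowr (emeasure lborel {y. s < G y}) r)"

lemma borel_measurable_superlevel_weight[measurable]:
  assumes [measurable]: "G \<in> borel_measurable borel"
  shows "superlevel_weight G c r \<in> borel_measurable borel"
  unfolding superlevel_weight_def[abs_def] by (cases "r = 0") (simp_all, measurable)

text \<open>The endpoint estimate in terms of level sets alone: the two integrals over
  \<open>s\<close> are controlled by the norms of \<open>F\<close> in L^(2,1) and of
  \<open>G\<close> in L^(1/r,1), or L^\<infinity> for r = 0. One constant serves all
  \<open>r\<close>, since the two estimates being interpolated do not depend on it.\<close>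

definition bilin_avg_level_bound :: "real \<Rightarrow> real \<Rightarrow> bool" where
  "bilin_avg_level_bound \<theta> K \<longleftrightarrow> 0 \<le> K \<and>
    (\<forall>F G B b c r. F \<in> borel_measurable borel \<and> (\<forall>x. 0 \<le> F x) \<and> G \<in> borel_measurable borel \<and> (\<forall>x. 0 \<le> G x) \<and>
      B \<in> sets borel \<and> emeasure lborel B = ennreal b \<and> 0 < b \<and> 0 \<le> r \<and> r \<le> 1 / 2 \<and>
      (r = 0 \<longrightarrow> (\<forall>x. G x \<le> c)) \<longrightarrow>
      (\<integral>\<^sup>+x. indicator B x * bilin_avg \<theta> (\<lambda>x. ennreal (F x)) (\<lambda>x. ennreal (G x)) x \<partial>lborel)
      \<le> ennreal K * (\<integral>\<^sup>+s. indicator {0..} s * epowr (emeasure lborel {y. s < F y}) (1 / 2) \<partial>lborel)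
         * (\<integral>\<^sup>+s. indicator {0..} s * superlevel_weight G c r s \<partial>lborel) * ennreal (b powr (1 / 2 - r)))"

lemma ex_bilin_avg_level_bound:
  assumes \<theta>: "0 < \<theta>" "\<theta> < 2 * pi"
  shows "\<exists>K. bilin_avg_level_bound \<theta> K"
proof -
  obtain K0 where K0: "0 < K0" "\<And>a b. (\<integral>\<^sup>+t. min (a / ennreal (chord_sq t)) (b / ennreal (chord_sq (t + \<theta>))) \<partial>angle_measure)
    \<le> ennreal K0 * epowr a (1 / 2) * epowr b (1 / 2)"
    using nn_integral_min_two_chord_sq[OF \<theta>] by blast
  \<comment> \<open>Dominates the constants of both estimates, so that they share the factor
    required for interpolation.\<close>
  define K where "K = max K0 (2 * pi)"
  have K: "0 \<le> K" "K0 \<le> K" "2 * pi \<le> K"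
    using K0(1) by (auto simp: K_def)
  have two: "(\<integral>\<^sup>+t. min (min (e / ennreal (chord_sq t)) (f / ennreal (chord_sq (t + \<theta>)))) (ennreal b) \<partial>angle_measure)
      \<le> ennreal K * epowr e (1 / 2) * epowr f (1 / 2)" for e f b
  proof -
    have "(\<integral>\<^sup>+t. min (min (e / ennreal (chord_sq t)) (f / ennreal (chord_sq (t + \<theta>)))) (ennreal b) \<partial>angle_measure)
        \<le> (\<integral>\<^sup>+t. min (e / ennreal (chord_sq t)) (f / ennreal (chord_sq (t + \<theta>))) \<partial>angle_measure)"
      by (intro nn_integral_mono min.cobounded1)
    also have "\<dots> \<le> ennreal K0 * epowr e (1 / 2) * epowr f (1 / 2)"
      by (rule K0)
    also have "\<dots> \<le> ennreal K * epowr e (1 / 2) * epowr f (1 / 2)"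
      using K by (intro mult_right_mono ennreal_leI) auto
    finally show ?thesis .
  qed
  have one: "(\<integral>\<^sup>+t. min (min (e / ennreal (chord_sq t)) (f / ennreal (chord_sq (t + \<theta>)))) (ennreal b) \<partial>angle_measure)
      \<le> ennreal K * epowr e (1 / 2) * ennreal (b powr (1 / 2))" if "0 < b" for e f b
  proof -
    have "(\<integral>\<^sup>+t. min (min (e / ennreal (chord_sq t)) (f / ennreal (chord_sq (t + \<theta>)))) (ennreal b) \<partial>angle_measure)
        \<le> (\<integral>\<^sup>+t. min (e / ennreal (chord_sq t)) (ennreal b) \<partial>angle_measure)"
      by (intro nn_integral_mono min.mono min.cobounded1 order_refl)
    also have "\<dots> \<le> ennreal (2 * pi) * epowr e (1 / 2) * epowr (ennreal b) (1 / 2)"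
      by (rule nn_integral_min_chord_sq)
    also have "\<dots> \<le> ennreal K * epowr e (1 / 2) * epowr (ennreal b) (1 / 2)"
      using K by (intro mult_right_mono ennreal_leI) auto
    finally show ?thesis
      using that by (simp add: epowr_ennreal)
  qed
  have "bilin_avg_level_bound \<theta> K"
    unfolding bilin_avg_level_bound_def
  proof (intro conjI K(1) allI impI, elim conjE)
    fix F G :: "real^2 \<Rightarrow> real" and B :: "(real^2) set" and b c r :: real
    assume [measurable]: "F \<in> borel_measurable borel" "G \<in> borel_measurable borel" "B \<in> sets borel"
      and F: "\<forall>x. 0 \<le> F x" and G: "\<forall>x. 0 \<le> G x" and B: "emeasure lborel B = ennreal b" "0 < b"
      and r: "0 \<le> r" "r \<le> 1 / 2" and Gc: "r = 0 \<longrightarrow> (\<forall>x. G x \<le> c)"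
    let ?e = "\<lambda>s. emeasure lborel {y. s < F y}" and ?f = "\<lambda>s. emeasure lborel {y. s < G y}"
    have key: "(\<integral>\<^sup>+t. min (min (?e s / ennreal (chord_sq t)) (?f s' / ennreal (chord_sq (t + \<theta>)))) (ennreal b) \<partial>angle_measure)
      \<le> ennreal K * epowr (?e s) (1 / 2) * superlevel_weight G c r s' * ennreal (b powr (1 / 2 - r))" for s s'
    proof (cases "r = 0")
      case False
      with epowr_interpolate[OF two one[OF B(2)]] r B show ?thesis
        by (simp add: superlevel_weight_def)
    next
      case True
      show ?thesis
      proof (cases "s' < c")
        case True
        with one[OF B(2), of "?e s" "?f s'"] \<open>r = 0\<close> show ?thesis
          by (simp add: superlevel_weight_def)
      next
        case False
        \<comment> \<open>Beyond the bound \<open>c\<close> the superlevel set of \<open>G\<close>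
          is empty, matching the vanishing of the weight.\<close>
        then have "\<not> s' < G y" for y
          using Gc \<open>r = 0\<close> by (meson not_less order.trans)
        then show ?thesis by simp
      qed
    qed
    have "(\<integral>\<^sup>+x. indicator B x * bilin_avg \<theta> (\<lambda>x. ennreal (F x)) (\<lambda>x. ennreal (G x)) x \<partial>lborel)
      \<le> (\<integral>\<^sup>+s. indicator {0..} s * (\<integral>\<^sup>+s'. indicator {0..} s' * (\<integral>\<^sup>+t.
          min (min (?e s / ennreal (chord_sq t)) (?f s' / ennreal (chord_sq (t + \<theta>)))) (ennreal b)
          \<partial>angle_measure) \<partial>lborel) \<partial>lborel)"
      using integral_bilin_avg_le_superlevel[of F G B \<theta>] F G \<theta> B by simp
    also have "\<dots> \<le> (\<integral>\<^sup>+s. indicator {0..} s * (\<integral>\<^sup>+s'. indicator {0..} s' * 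
        (ennreal K * epowr (?e s) (1 / 2) * superlevel_weight G c r s' * ennreal (b powr (1 / 2 - r))) \<partial>lborel) \<partial>lborel)"
      by (intro nn_integral_mono mult_left_mono key) auto
    also have "\<dots> = (\<integral>\<^sup>+s. (ennreal K * ennreal (b powr (1 / 2 - r)) * (\<integral>\<^sup>+s'. indicator {0..} s' * superlevel_weight G c r s' \<partial>lborel)) *
        (indicator {0..} s * epowr (?e s) (1 / 2)) \<partial>lborel)"
    proof (intro nn_integral_cong)
      fix s :: real
      have "(\<integral>\<^sup>+s'. indicator {0..} s' * 
        (ennreal K * epowr (?e s) (1 / 2) * superlevel_weight G c r s' * ennreal (b powr (1 / 2 - r))) \<partial>lborel)
        = (\<integral>\<^sup>+s'. (ennreal K * ennreal (b powr (1 / 2 - r)) * epowr (?e s) (1 / 2)) * (indicator {0..} s' * superlevel_weight G c r s') \<partial>lborel)"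
        by (intro nn_integral_cong) (simp only: mult_ac)
      also have "\<dots> = (ennreal K * ennreal (b powr (1 / 2 - r)) * epowr (?e s) (1 / 2)) * (\<integral>\<^sup>+s'. indicator {0..} s' * superlevel_weight G c r s' \<partial>lborel)"
        by (rule nn_integral_cmult) measurable
      finally show "indicator {0..} s * (\<integral>\<^sup>+s'. indicator {0..} s' * 
        (ennreal K * epowr (?e s) (1 / 2) * superlevel_weight G c r s' * ennreal (b powr (1 / 2 - r))) \<partial>lborel)
        = (ennreal K * ennreal (b powr (1 / 2 - r)) * (\<integral>\<^sup>+s'. indicator {0..} s' * superlevel_weight G c r s' \<partial>lborel)) *
        (indicator {0..} s * epowr (?e s) (1 / 2))"
        by (simp only: mult_ac)
    qed
    also have "\<dots> = (ennreal K * ennreal (b powr (1 / 2 - r)) * (\<integral>\<^sup>+s'. indicator {0..} s' * superlevel_weight G c r s' \<partial>lborel)) *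
        (\<integral>\<^sup>+s. indicator {0..} s * epowr (?e s) (1 / 2) \<partial>lborel)"
      by (rule nn_integral_cmult) measurable
    finally show "(\<integral>\<^sup>+x. indicator B x * bilin_avg \<theta> (\<lambda>x. ennreal (F x)) (\<lambda>x. ennreal (G x)) x \<partial>lborel)
      \<le> ennreal K * (\<integral>\<^sup>+s. indicator {0..} s * epowr (?e s) (1 / 2) \<partial>lborel)
       * (\<integral>\<^sup>+s. indicator {0..} s * superlevel_weight G c r s \<partial>lborel) * ennreal (b powr (1 / 2 - r))"
      by (simp only: mult_ac)
  qed
  then show ?thesis ..
qed

subsection \<open>Minkowski's inequality\<close>

text \<open>The convex function y^p lies above its tangent at \<open>l\<close>. This is Young's
  inequality for \<open>y\<close> and l^(p-1).\<close>

lemma tangent_power_le: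
  fixes p l y :: real
  assumes p: "1 < p" and "0 \<le> l" "0 \<le> y"
  shows "p * l powr (p - 1) * y \<le> y powr p + (p - 1) * l powr p"
proof -
  define q where "q = p / (p - 1)"
  have q: "1 < q" "1 / p + 1 / q = 1"
    using p by (auto simp: q_def field_simps)
  have "y * l powr (p - 1) \<le> y powr p / p + (l powr (p - 1)) powr q / q"
    using Youngs_inequality[OF p q assms(3)] by simp
  also have "(l powr (p - 1)) powr q = l powr p"
    using p by (simp add: powr_powr q_def)
  finally have "p * (y * l powr (p - 1)) \<le> p * (y powr p / p + l powr p / q)"
    using p by (intro mult_left_mono) auto
  also have "\<dots> = y powr p + (p - 1) * l powr p"
    using p by (simp add: q_def field_simps)
  finally show ?thesis
    by (simp add: mult_ac)
qed

text \<open>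
  Up to the factor \<open>N\<close>, the weight \<open>w t\<close> stands for the \<open>L\<^sup>p\<close> norm of the slice of \<open>H\<close> at \<open>t\<close>. The
  proof is a tangent line argument in place of duality.
\<close>

lemma (in pair_sigma_finite) Minkowski_weighted:
  fixes H :: "'a \<Rightarrow> 'b \<Rightarrow> real"
  assumes H[measurable]: "(\<lambda>(x, t). H x t) \<in> borel_measurable (M1 \<Otimes>\<^sub>M M2)" and H0: "\<And>x t. 0 \<le> H x t"
    and w[measurable]: "w \<in> borel_measurable M2" and w0: "AE t in M2. 0 < w t"
    and W: "(\<integral>\<^sup>+t. ennreal (w t) \<partial>M2) = ennreal W" "0 < W"
    and p: "1 < p" and N: "0 \<le> N"
    and slice: "AE t in M2. (\<integral>\<^sup>+x. ennreal (H x t powr p) \<partial>M1) \<le> ennreal (w t powr p * N)"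
  shows "AE x in M1. (\<integral>\<^sup>+t. ennreal (H x t) \<partial>M2) < \<infinity>"
    and "(\<integral>\<^sup>+x. ennreal (enn2real (\<integral>\<^sup>+t. ennreal (H x t) \<partial>M2) powr p) \<partial>M1) \<le> ennreal (W powr p * N)"
proof -
  \<comment> \<open>The power 1 - p is chosen so that the slice bound w^p * N turns into w * N,
    which integrates to W * N.\<close>
  define R where "R x = (\<integral>\<^sup>+t. ennreal (w t powr (1 - p)) * ennreal (H x t powr p) \<partial>M2)" for x
  have Rm[measurable]: "R \<in> borel_measurable M1"
    unfolding R_def by measurable
  have "(\<integral>\<^sup>+x. R x \<partial>M1) = (\<integral>\<^sup>+t. \<integral>\<^sup>+x. ennreal (w t powr (1 - p)) * ennreal (H x t powr p) \<partial>M1 \<partial>M2)"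
    unfolding R_def by (rule Fubini'[symmetric]) measurable
  also have "\<dots> = (\<integral>\<^sup>+t. ennreal (w t powr (1 - p)) * (\<integral>\<^sup>+x. ennreal (H x t powr p) \<partial>M1) \<partial>M2)"
    by (intro nn_integral_cong nn_integral_cmult) measurable
  also have "\<dots> \<le> (\<integral>\<^sup>+t. ennreal (w t) * ennreal N \<partial>M2)"
  proof (rule nn_integral_mono_AE)
    show "AE t in M2. ennreal (w t powr (1 - p)) * (\<integral>\<^sup>+x. ennreal (H x t powr p) \<partial>M1) \<le> ennreal (w t) * ennreal N"
      using slice w0
    proof eventually_elim
      case (elim t)
      have "ennreal (w t powr (1 - p)) * (\<integral>\<^sup>+x. ennreal (H x t powr p) \<partial>M1)
          \<le> ennreal (w t powr (1 - p)) * ennreal (w t powr p * N)"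
        using elim by (intro mult_left_mono) auto
      also have "\<dots> = ennreal (w t powr (1 - p) * w t powr p * N)"
        using N by (simp add: ennreal_mult' mult.assoc)
      also have "w t powr (1 - p) * w t powr p = w t"
        using elim by (simp add: powr_add[symmetric])
      finally show ?case
        using N elim by (simp add: ennreal_mult)
    qed
  qed
  also have "\<dots> = ennreal W * ennreal N"
    by (subst nn_integral_multc) (simp_all add: W)
  finally have intR: "(\<integral>\<^sup>+x. R x \<partial>M1) \<le> ennreal W * ennreal N" .
  then have "(\<integral>\<^sup>+x. R x \<partial>M1) \<noteq> \<infinity>"
    by (auto simp: ennreal_mult_eq_top_iff top_unique)
  then have Rfin: "AE x in M1. R x \<noteq> \<infinity>"
    by (intro nn_integral_PInf_AE) auto
  \<comment> \<open>The tangent inequality at \<open>l\<close> for \<open>H x t / w t\<close>,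
    multiplied by \<open>w t\<close> and integrated over \<open>t\<close>.\<close>
  have young: "ennreal (p * l powr (p - 1)) * (\<integral>\<^sup>+t. ennreal (H x t) \<partial>M2) \<le> R x + ennreal ((p - 1) * l powr p * W)"
    if "0 \<le> l" "x \<in> space M1" for l x
  proof -
    have [measurable]: "(\<lambda>t. H x t) \<in> borel_measurable M2"
      using that(2) by measurable
    have "ennreal (p * l powr (p - 1)) * (\<integral>\<^sup>+t. ennreal (H x t) \<partial>M2)
        = (\<integral>\<^sup>+t. ennreal (p * l powr (p - 1)) * ennreal (H x t) \<partial>M2)"
      by (rule nn_integral_cmult[symmetric]) measurable
    also have "\<dots> \<le> (\<integral>\<^sup>+t. ennreal (w t powr (1 - p)) * ennreal (H x t powr p)
        + ennreal ((p - 1) * l powr p) * ennreal (w t) \<partial>M2)"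
    proof (rule nn_integral_mono_AE)
      show "AE t in M2. ennreal (p * l powr (p - 1)) * ennreal (H x t)
          \<le> ennreal (w t powr (1 - p)) * ennreal (H x t powr p) + ennreal ((p - 1) * l powr p) * ennreal (w t)"
        using w0
      proof eventually_elim
        case (elim t)
        have "p * l powr (p - 1) * (H x t / w t) \<le> (H x t / w t) powr p + (p - 1) * l powr p"
          using elim p that(1) H0 by (intro tangent_power_le) auto
        then have "w t * (p * l powr (p - 1) * (H x t / w t)) \<le> w t * ((H x t / w t) powr p + (p - 1) * l powr p)"
          using elim by (intro mult_left_mono) auto
        also have "\<dots> = w t powr (1 - p) * H x t powr p + (p - 1) * l powr p * w t"
        proof -
          have "w t * (H x t / w t) powr p = w t powr (1 - p) * H x t powr p"
            using elim H0 by (simp add: powr_divide powr_diff)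
          then show ?thesis
            by (simp add: distrib_left mult_ac)
        qed
        finally have "p * l powr (p - 1) * H x t \<le> w t powr (1 - p) * H x t powr p + (p - 1) * l powr p * w t"
          using elim by simp
        then have "ennreal (p * l powr (p - 1) * H x t)
            \<le> ennreal (w t powr (1 - p) * H x t powr p + (p - 1) * l powr p * w t)"
          by (rule ennreal_leI)
        then show ?case
          using elim p H0 by (simp add: ennreal_mult)
      qed
    qed
    also have "\<dots> = R x + ennreal ((p - 1) * l powr p) * (\<integral>\<^sup>+t. ennreal (w t) \<partial>M2)"
      unfolding R_def by (subst nn_integral_add) (auto simp: nn_integral_cmult)
    also have "\<dots> = R x + ennreal ((p - 1) * l powr p * W)"
      using p W by (simp add: ennreal_mult)
    finally show ?thesis .
  qed
  have fin: "(\<integral>\<^sup>+t. ennreal (H x t) \<partial>M2) < \<infinity>" if "R x \<noteq> \<infinity>" "x \<in> space M1" for x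
  proof -
    \<comment> \<open>The tangent at l = 1 already yields finiteness.\<close>
    have "ennreal (p * 1 powr (p - 1)) * (\<integral>\<^sup>+t. ennreal (H x t) \<partial>M2)
        \<le> R x + ennreal ((p - 1) * 1 powr p * W)"
      using that by (intro young) auto
    also have "\<dots> < \<infinity>"
      using that by (simp add: less_top)
    finally have "ennreal (p * 1 powr (p - 1)) * (\<integral>\<^sup>+t. ennreal (H x t) \<partial>M2) < \<infinity>" .
    then show ?thesis
      using p by (auto simp: ennreal_mult_less_top)
  qed
  show "AE x in M1. (\<integral>\<^sup>+t. ennreal (H x t) \<partial>M2) < \<infinity>"
    using Rfin AE_space by eventually_elim (rule fin)
  have "(\<integral>\<^sup>+x. ennreal (enn2real (\<integral>\<^sup>+t. ennreal (H x t) \<partial>M2) powr p) \<partial>M1)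
      \<le> (\<integral>\<^sup>+x. ennreal (W powr (p - 1)) * R x \<partial>M1)"
  proof (rule nn_integral_mono_AE)
    show "AE x in M1. ennreal (enn2real (\<integral>\<^sup>+t. ennreal (H x t) \<partial>M2) powr p) \<le> ennreal (W powr (p - 1)) * R x"
      using Rfin AE_space
    proof eventually_elim
      case (elim x)
      define m where "m = enn2real (\<integral>\<^sup>+t. ennreal (H x t) \<partial>M2)"
      have m: "(\<integral>\<^sup>+t. ennreal (H x t) \<partial>M2) = ennreal m" "0 \<le> m"
        using fin[OF elim] by (auto simp: m_def less_top)
      obtain r where r: "R x = ennreal r" "0 \<le> r"
        using elim by (cases "R x") auto
      \<comment> \<open>The mean of H / w with respect to the weight \<open>w\<close>. With this
        tangent point the inequality becomes Jensen's, m^p \<le> W^(p-1) * R.\<close>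
      define l where "l = m / W"
      have l: "0 \<le> l" "m = l * W" using m W by (auto simp: l_def)
      have "ennreal (p * l powr (p - 1) * m) \<le> ennreal (r + (p - 1) * l powr p * W)"
        using young[OF l(1), of x] elim m r p l W by (simp add: ennreal_mult[symmetric] ennreal_plus[symmetric] del: ennreal_plus)
      then have "p * l powr (p - 1) * m \<le> r + (p - 1) * l powr p * W"
        using r p W by (subst (asm) ennreal_le_iff) auto
      moreover have "l powr (p - 1) * l = l powr p"
        using l p by (cases "l = 0") (auto simp: powr_diff)
      then have "p * l powr (p - 1) * m = p * (l powr p * W)"
        using l(2) by (metis mult.assoc)
      moreover have "(p - 1) * l powr p * W = p * (l powr p * W) - l powr p * W"
        by (simp add: algebra_simps)
      ultimately have "l powr p * W \<le> r"
        by linarith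
      moreover have "m powr p = W powr (p - 1) * (l powr p * W)"
        using l W p by (simp add: powr_mult powr_diff)
      ultimately have "m powr p \<le> W powr (p - 1) * r"
        by (simp add: mult_left_mono)
      then show ?case
        unfolding m_def[symmetric] r using r by (simp add: ennreal_mult[symmetric] ennreal_leI)
    qed
  qed
  also have "\<dots> = ennreal (W powr (p - 1)) * (\<integral>\<^sup>+x. R x \<partial>M1)"
    by (rule nn_integral_cmult) measurable
  also have "\<dots> \<le> ennreal (W powr (p - 1)) * (ennreal W * ennreal N)"
    using intR by (rule mult_left_mono) simp
  also have "\<dots> = ennreal (W powr p * N)"
    using W N by (simp add: ennreal_mult[symmetric] powr_diff)
  finally show "(\<integral>\<^sup>+x. ennreal (enn2real (\<integral>\<^sup>+t. ennreal (H x t) \<partial>M2) powr p) \<partial>M1) \<le> ennreal (W powr p * N)" .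
qed

subsection \<open>Weak type bounds and Lorentz norms\<close>

text \<open>
  Unlike the quasinorm of \<open>L\<^sup>p\<^sup>,\<^sup>\<infinity>\<close>, this bound is stable under integration of \<open>m\<close> over a parameter,
  including the case \<open>p = 1\<close>, \<open>r = 0\<close>.
\<close>

definition weak_bound :: "(real^2 \<Rightarrow> ennreal) \<Rightarrow> real \<Rightarrow> real \<Rightarrow> bool" where
  "weak_bound m K r \<longleftrightarrow> (\<forall>B b. B \<in> sets borel \<longrightarrow> emeasure lborel B = ennreal b \<longrightarrow> 0 < b \<longrightarrow>
     (\<integral>\<^sup>+x. indicator B x * m x \<partial>lborel) \<le> ennreal (K * b powr r))"

text \<open>Chebyshev's argument: testing on a superlevel set of measure \<open>b\<close> gives a *
  b \<le> K * b^(1-r), which is solved for \<open>b\<close>. The division needs \<open>b\<close>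
  finite, so the set is first cut down to balls. Superlevel sets of \<open>m\<close> are used
  because they are Borel and contain those of \<open>h\<close> up to a null set.\<close>

lemma distr_fun_le_of_weak:
  fixes h :: "real^2 \<Rightarrow> complex" and m :: "real^2 \<Rightarrow> ennreal"
  assumes h: "h \<in> borel_measurable lebesgue" and m[measurable]: "m \<in> borel_measurable borel"
    and le: "AE x in lborel. ennreal (norm (h x)) \<le> m x"
    and weak: "weak_bound m K (1 - r)"
    and r: "0 < r" and K: "0 \<le> K" and a: "0 < a"
  shows "distr_fun lebesgue h (ennreal a) \<le> ennreal ((K / a) powr (1 / r))"
proof -
  define S where "S n = {x. ennreal a < m x} \<inter> ball 0 (real n)" for n
  have Sm[measurable]: "S n \<in> sets borel" for n
    unfolding S_def by measurable
  have bound: "emeasure lborel (S n) \<le> ennreal ((K / a) powr (1 / r))" for n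
  proof -
    have "emeasure lborel (S n) \<le> emeasure lborel (ball (0 :: real^2) (real n))"
      by (intro emeasure_mono) (auto simp: S_def)
    also have "\<dots> < \<infinity>"
      by (rule emeasure_lborel_ball_finite)
    finally obtain b where b: "emeasure lborel (S n) = ennreal b" "0 \<le> b"
      by (cases "emeasure lborel (S n)") auto
    show ?thesis
    proof (cases "b = 0")
      case False
      with b have b0: "0 < b" by simp
      have "ennreal (a * b) = (\<integral>\<^sup>+x. ennreal a * indicator (S n) x \<partial>lborel)"
        using a b by (simp add: nn_integral_cmult_indicator ennreal_mult)
      also have "\<dots> \<le> (\<integral>\<^sup>+x. indicator (S n) x * m x \<partial>lborel)"
        by (intro nn_integral_mono) (auto simp: indicator_def S_def)
      also have "\<dots> \<le> ennreal (K * b powr (1 - r))"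
        using weak Sm b(1) b0 by (simp add: weak_bound_def)
      finally have "a * b \<le> K * b powr (1 - r)"
        using K by (subst (asm) ennreal_le_iff) auto
      then have "a * (b powr r * b powr (1 - r)) \<le> K * b powr (1 - r)"
        using b0 by (simp add: powr_add[symmetric])
      then have "a * b powr r \<le> K"
        using b0 by (simp add: mult.assoc[symmetric])
      then have "(b powr r) powr (1 / r) \<le> (K / a) powr (1 / r)"
        using a r by (intro powr_mono2) (auto simp: field_simps)
      then show ?thesis
        using b r b0 by (simp add: powr_powr ennreal_leI)
    qed (use b in simp)
  qed
  have "distr_fun lebesgue h (ennreal a) \<le> emeasure lebesgue {x. ennreal a < m x}"
    unfolding distr_fun_def
  proof (rule emeasure_mono_AE)
    show "AE x in lebesgue. x \<in> {x \<in> space lebesgue. ennreal a < ennreal (norm (h x))} \<longrightarrow> x \<in> {x. ennreal a < m x}"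
      using AE_completion[OF le] by eventually_elim (auto intro: less_le_trans)
  qed (intro sets_completionI_sets, simp)
  also have "\<dots> = emeasure lborel {x. ennreal a < m x}"
    by (simp add: sets_completionI_sets main_part_sets)
  also have "{x. ennreal a < m x} = (\<Union>n. S n)"
    using reals_Archimedean2 by (auto simp: S_def)
  also have "emeasure lborel \<dots> = (SUP n. emeasure lborel (S n))"
    by (intro SUP_emeasure_incseq[symmetric]) (auto simp: incseq_def S_def)
  also have "\<dots> \<le> ennreal ((K / a) powr (1 / r))"
    by (intro SUP_least bound)
  finally show ?thesis .
qed

lemma lorentz_norm_weak_le:
  fixes p :: ennreal
  assumes p: "p \<noteq> \<infinity>" "0 < enn2real p" and K: "0 \<le> K"
    and distr: "\<And>a. 0 < a \<Longrightarrow> distr_fun M h (ennreal a) \<le> ennreal ((K / a) powr enn2real p)"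
  shows "lorentz_norm M p \<infinity> h \<le> ennreal K"
proof -
  define r where "r = 1 / enn2real p"
  have r: "0 < r" "enn2real p = 1 / r" using p by (auto simp: r_def)
  have "ennreal (t powr r) * decr_rearr M h t \<le> ennreal K" if t: "0 < t" for t
  proof -
    have "decr_rearr M h t \<le> ennreal (K * t powr - r)"
    proof (rule ennreal_le_epsilon)
      fix e :: real assume e: "0 < e"
      \<comment> \<open>The summand \<open>e\<close> keeps \<open>a\<close> positive even when K =
        0, as the distribution bound is assumed only for positive levels.\<close>
      define a where "a = K * t powr - r + e"
      have a: "0 < a" using K e by (simp add: a_def add_nonneg_pos)
      have "K * t powr - r \<le> a" using e by (simp add: a_def)
      then have "K / a \<le> t powr r"
        using a t by (simp add: powr_minus field_simps)
      then have "(K / a) powr (1 / r) \<le> (t powr r) powr (1 / r)"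
        using K a r by (intro powr_mono2) auto
      also have "\<dots> = t"
        using t r by (simp add: powr_powr)
      finally have "distr_fun M h (ennreal a) \<le> ennreal t"
        using distr[OF a] r by (metis ennreal_leI order.trans)
      then have "decr_rearr M h t \<le> ennreal a"
        unfolding decr_rearr_def by (intro Inf_lower) simp
      also have "\<dots> = ennreal (K * t powr - r) + ennreal e"
        using K e by (simp add: a_def)
      finally show "decr_rearr M h t \<le> ennreal (K * t powr - r) + ennreal e" .
    qed
    then have "ennreal (t powr r) * decr_rearr M h t \<le> ennreal (t powr r) * ennreal (K * t powr - r)"
      by (rule mult_left_mono) simp
    also have "\<dots> = ennreal K"
      using t K by (simp add: ennreal_mult[symmetric] powr_minus)
    finally show ?thesis .
  qed
  then show ?thesis
    using p unfolding lorentz_norm_def r_def by (auto intro!: SUP_least)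
qed

section \<open>Distribution functions and the L^(p,1) norm\<close>

lemma epowr_1: "epowr x 1 = x"
  by (cases x) (auto simp: epowr_def)

text \<open>Turns a power of a distribution function into an integral over the region where
  \<open>t\<close> lies below it, so that Fubini can be applied to that region. Infinite
  \<open>d\<close> is included.\<close>

lemma nn_integral_powr_upto:
  assumes r: "0 < r"
  shows "ennreal r * (\<integral>\<^sup>+t. indicator {0<..} t * (ennreal (t powr (r - 1)) * indicator {t. ennreal t < d} t) \<partial>lborel)
    = epowr d r"
proof -
  let ?I = "\<lambda>d. ennreal r * (\<integral>\<^sup>+t. indicator {0<..} t * (ennreal (t powr (r - 1)) * indicator {t. ennreal t < d} t) \<partial>lborel)"
  have fin: "?I (ennreal c) = ennreal (c powr r)" if c: "0 \<le> c" for c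
  proof -
    have "(\<integral>\<^sup>+t. indicator {0<..} t * (ennreal (t powr (r - 1)) * indicator {t. ennreal t < ennreal c} t) \<partial>lborel)
        = (\<integral>\<^sup>+t. ennreal (t powr (r - 1)) * indicator {0..c} t \<partial>lborel)"
    proof (rule nn_integral_cong_AE)
      show "AE t in lborel. indicator {0<..} t * (ennreal (t powr (r - 1)) * indicator {t. ennreal t < ennreal c} t)
          = ennreal (t powr (r - 1)) * indicator {0..c} t"
        using AE_lborel_singleton[of c] AE_lborel_singleton[of 0]
        by eventually_elim (auto simp: indicator_def ennreal_less_iff)
    qed
    also have "\<dots> = ennreal (c powr r / r)"
      using has_integral_powr_from_0[of "r - 1" c] r c by (intro nn_integral_has_integral_lebesgue') auto
    finally show ?thesis
      using r by (simp add: ennreal_mult[symmetric])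
  qed
  show ?thesis
  proof (cases d)
    case (real c)
    then show ?thesis using fin[of c] by (simp add: epowr_def)
  next
    case top
    have "?I d = top"
    proof (rule ccontr)
      assume "?I d \<noteq> top"
      then obtain x where x: "?I d = ennreal x" "0 \<le> x"
        by (cases "?I d") auto
      \<comment> \<open>Chosen with c^r = x + 1, so that the part below \<open>c\<close> already
        exceeds the supposed finite value \<open>x\<close>.\<close>
      define c where "c = (x + 1) powr (1 / r)"
      have "ennreal (c powr r) = ?I (ennreal c)"
        by (rule fin[symmetric]) (simp add: c_def)
      also have "\<dots> \<le> ?I d"
        unfolding top by (intro mult_left_mono nn_integral_mono) (auto simp: indicator_def)
      finally have "ennreal (c powr r) \<le> ?I d" .
      moreover have "c powr r = x + 1"
        using x r by (simp add: c_def powr_powr)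
      ultimately show False
        using x by (simp del: ennreal_plus)
    qed
    then show ?thesis using top by (simp add: epowr_def)
  qed
qed

text \<open>Both sides measure the region under the graph of the distribution function with weight r
  * t^(r-1), sliced in the two directions. The slice at height \<open>t\<close> is contained in the
  interval from 0 to the decreasing rearrangement at \<open>t\<close>.\<close>

lemma integral_distr_fun_le_lorentz_norm:
  fixes p :: ennreal
  assumes p: "p \<noteq> \<infinity>" "0 < enn2real p"
    and h[measurable]: "h \<in> borel_measurable M"
    and meas[measurable]: "(\<lambda>s. distr_fun M h (ennreal s)) \<in> borel_measurable borel"
  shows "(\<integral>\<^sup>+s. indicator {0..} s * epowr (distr_fun M h (ennreal s)) (1 / enn2real p) \<partial>lborel)
    \<le> ennreal (1 / enn2real p) * lorentz_norm M p 1 h"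
proof -
  define r where "r = 1 / enn2real p"
  have r: "0 < r" using p by (simp add: r_def)
  let ?d = "\<lambda>s. distr_fun M h (ennreal s)"
  have rearr: "(\<integral>\<^sup>+s. indicator {0..} s * indicator {s. ennreal t < ?d s} s \<partial>lborel) \<le> decr_rearr M h t" for t
  proof (cases "decr_rearr M h t")
    case (real c)
    have "(\<integral>\<^sup>+s. indicator {0..} s * indicator {s. ennreal t < ?d s} s \<partial>lborel) \<le> (\<integral>\<^sup>+s. indicator {0..c} s \<partial>lborel)"
    proof (rule nn_integral_mono)
      fix s
      have "s \<le> c" if "0 \<le> s" "ennreal t < ?d s"
      proof (rule ccontr)
        assume "\<not> s \<le> c"
        then have "decr_rearr M h t < ennreal s"
          using real by (simp add: ennreal_lessI)
        then obtain a where a: "distr_fun M h a \<le> ennreal t" "a < ennreal s"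
          unfolding decr_rearr_def by (auto simp: Inf_less_iff)
        have "?d s \<le> distr_fun M h a"
          unfolding distr_fun_def using a(2) by (intro emeasure_mono) (auto intro: less_trans)
        with a that show False by auto
      qed
      then show "indicator {0..} s * indicator {s. ennreal t < ?d s} s \<le> (indicator {0..c} s :: ennreal)"
        by (auto simp: indicator_def)
    qed
    also have "\<dots> = ennreal c"
      using real by simp
    finally show ?thesis using real by simp
  qed simp
  have "(\<integral>\<^sup>+s. indicator {0..} s * epowr (?d s) r \<partial>lborel)
      = (\<integral>\<^sup>+s. \<integral>\<^sup>+t. ennreal r * (indicator {0<..} t * ennreal (t powr (r - 1)) * (indicator {0..} s * indicator {s. ennreal t < ?d s} s)) \<partial>lborel \<partial>lborel)"
  proof (rule nn_integral_cong)
    fix s :: real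
    have "indicator {0..} s * epowr (?d s) r = indicator {0..} s * (ennreal r * (\<integral>\<^sup>+t. indicator {0<..} t * (ennreal (t powr (r - 1)) * indicator {t. ennreal t < ?d s} t) \<partial>lborel))"
      unfolding nn_integral_powr_upto[OF r] ..
    also have "\<dots> = (indicator {0..} s * ennreal r) * (\<integral>\<^sup>+t. indicator {0<..} t * (ennreal (t powr (r - 1)) * indicator {t. ennreal t < ?d s} t) \<partial>lborel)"
      by (simp only: mult.assoc)
    also have "\<dots> = (\<integral>\<^sup>+t. (indicator {0..} s * ennreal r) * (indicator {0<..} t * (ennreal (t powr (r - 1)) * indicator {t. ennreal t < ?d s} t)) \<partial>lborel)"
      by (rule nn_integral_cmult[symmetric]) measurable
    also have "\<dots> = (\<integral>\<^sup>+t. ennreal r * (indicator {0<..} t * ennreal (t powr (r - 1)) * (indicator {0..} s * indicator {s. ennreal t < ?d s} s)) \<partial>lborel)"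
      by (intro nn_integral_cong) (auto simp: indicator_def)
    finally show "indicator {0..} s * epowr (?d s) r = \<dots>" .
  qed
  also have "\<dots> = (\<integral>\<^sup>+t. \<integral>\<^sup>+s. ennreal r * (indicator {0<..} t * ennreal (t powr (r - 1)) * (indicator {0..} s * indicator {s. ennreal t < ?d s} s)) \<partial>lborel \<partial>lborel)"
    by (rule lborel_pair.Fubini'[symmetric]) measurable
  also have "\<dots> = (\<integral>\<^sup>+t. ennreal r * (indicator {0<..} t * ennreal (t powr (r - 1)) * (\<integral>\<^sup>+s. indicator {0..} s * indicator {s. ennreal t < ?d s} s \<partial>lborel)) \<partial>lborel)"
    by (intro nn_integral_cong) (simp add: nn_integral_cmult mult.assoc)
  also have "\<dots> = ennreal r * (\<integral>\<^sup>+t. indicator {0<..} t * ennreal (t powr (r - 1)) * (\<integral>\<^sup>+s. indicator {0..} s * indicator {s. ennreal t < ?d s} s \<partial>lborel) \<partial>lborel)"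
    by (rule nn_integral_cmult) measurable
  also have "\<dots> \<le> ennreal r * (\<integral>\<^sup>+t. epowr (ennreal (t powr r) * decr_rearr M h t) 1 * ennreal (1 / t) * indicator {0<..} t \<partial>lborel)"
  proof (intro mult_left_mono nn_integral_mono)
    fix t :: real
    let ?I = "\<integral>\<^sup>+s. indicator {0..} s * indicator {s. ennreal t < ?d s} s \<partial>lborel"
    show "indicator {0<..} t * ennreal (t powr (r - 1)) * ?I
      \<le> epowr (ennreal (t powr r) * decr_rearr M h t) 1 * ennreal (1 / t) * indicator {0<..} t"
    proof (cases "0 < t")
      case True
      have eq: "ennreal (t powr (r - 1)) = ennreal (t powr r) * ennreal (1 / t)"
        using True by (simp add: ennreal_mult[symmetric] powr_diff)
      have "ennreal (t powr (r - 1)) * ?I \<le> ennreal (t powr (r - 1)) * decr_rearr M h t"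
        by (intro mult_left_mono rearr) simp
      also have "\<dots> = ennreal (t powr r) * decr_rearr M h t * ennreal (1 / t)"
        unfolding eq by (simp only: mult_ac)
      finally show ?thesis
        using True by (simp add: epowr_1)
    qed simp
  qed simp
  also have "\<dots> = ennreal r * lorentz_norm M p 1 h"
    using p by (simp add: lorentz_norm_def r_def epowr_1)
  finally show ?thesis
    by (simp add: r_def)
qed

lemma distr_fun_lebesgue:
  assumes [measurable]: "h \<in> borel_measurable lebesgue" "h' \<in> borel_measurable borel"
    and eq: "AE x in lborel. h x = h' x" and s: "0 \<le> s"
  shows "distr_fun lebesgue h (ennreal s) = emeasure lborel {y. s < norm (h' y)}"
proof -
  have "distr_fun lebesgue h (ennreal s) = emeasure lebesgue {y. s < norm (h' y)}"
    unfolding distr_fun_def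
  proof (rule emeasure_eq_AE)
    show "AE x in lebesgue. x \<in> {x \<in> space lebesgue. ennreal s < ennreal (norm (h x))} \<longleftrightarrow> x \<in> {y. s < norm (h' y)}"
      using AE_completion[OF eq] by eventually_elim (use s in \<open>simp add: ennreal_less_iff\<close>)
  qed (measurable, intro sets_completionI_sets, simp)
  then show ?thesis
    by (simp add: sets_completionI_sets main_part_sets)
qed

lemma borel_measurable_distr_fun_lebesgue:
  fixes h :: "real^2 \<Rightarrow> complex"
  assumes "h \<in> borel_measurable lebesgue" "h' \<in> borel_measurable borel"
    and "AE x in lborel. h x = h' x"
  shows "(\<lambda>s. distr_fun lebesgue h (ennreal s)) \<in> borel_measurable borel"
proof -
  note assms(2)[measurable]
  \<comment> \<open>For negative \<open>s\<close>, \<open>ennreal s\<close> is 0, whence the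
    maximum.\<close>
  have "distr_fun lebesgue h (ennreal s) = emeasure lborel {y. max 0 s < norm (h' y)}" for s
  proof -
    have "ennreal s = ennreal (max 0 s)"
      by (simp add: max_def ennreal_neg)
    then show ?thesis
      using distr_fun_lebesgue[OF assms, of "max 0 s"] by simp
  qed
  moreover have "(\<lambda>s. emeasure lborel {y. max 0 s < norm (h' y)}) \<in> borel_measurable borel"
    by (rule measurable_compose[OF _ borel_measurable_superlevel]) measurable
  ultimately show ?thesis
    by simp
qed

subsection \<open>Strong type bounds\<close>

text \<open>Here \<open>q\<close> is the reciprocal of the Lebesgue exponent.\<close>

definition Lp_bound :: "real \<Rightarrow> (real^2 \<Rightarrow> real) \<Rightarrow> real \<Rightarrow> bool" where
  "Lp_bound q F n \<longleftrightarrow>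
     (if q = 0 then \<forall>x. F x \<le> n
      else (\<integral>\<^sup>+x. ennreal (F x powr (1 / q)) \<partial>lborel) \<le> ennreal (n powr (1 / q)))"

section \<open>Borel representatives with norm bounds\<close>

lemma Borel_representative:
  fixes f :: "real^2 \<Rightarrow> complex"
  assumes "f \<in> borel_measurable lebesgue"
  obtains f' where "f' \<in> borel_measurable borel" "AE x in lborel. f x = f' x"
proof -
  note assms[measurable]
  obtain u :: "real^2 \<Rightarrow> real" where u[measurable]: "u \<in> borel_measurable lborel"
      "AE x in lborel. Re (f x) = u x"
    using completion_ex_borel_measurable_real[of "\<lambda>x. Re (f x)" lborel] by auto
  obtain v :: "real^2 \<Rightarrow> real" where v[measurable]: "v \<in> borel_measurable lborel"
      "AE x in lborel. Im (f x) = v x"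
    using completion_ex_borel_measurable_real[of "\<lambda>x. Im (f x)" lborel] by auto
  show thesis
  proof (rule that)
    show "(\<lambda>x. complex_of_real (u x) + \<i> * complex_of_real (v x)) \<in> borel_measurable borel"
      by measurable
    show "AE x in lborel. f x = complex_of_real (u x) + \<i> * complex_of_real (v x)"
      using u(2) v(2) by eventually_elim (simp add: complex_eq_iff)
  qed
qed

text \<open>The bound must hold everywhere, since the case of exponent \<infinity> is formulated
  pointwise below. Larger values occur only on a null set and are replaced by 0.\<close>

lemma bounded_Borel_representative:
  fixes f :: "real^2 \<Rightarrow> complex"
  assumes f: "f \<in> borel_measurable lebesgue" and bd: "AE x in lborel. norm (f x) \<le> c" and c: "0 \<le> c"
  obtains f' where "f' \<in> borel_measurable borel" "AE x in lborel. f x = f' x" "\<And>x. norm (f' x) \<le> c"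
proof -
  obtain f' where [measurable]: "f' \<in> borel_measurable borel" and f': "AE x in lborel. f x = f' x"
    using Borel_representative[OF f] .
  show thesis
  proof (rule that)
    show "(\<lambda>x. if norm (f' x) \<le> c then f' x else 0) \<in> borel_measurable borel"
      by measurable
    show "AE x in lborel. f x = (if norm (f' x) \<le> c then f' x else 0)"
      using f' bd by eventually_elim simp
  qed (use c in auto)
qed

lemma esssup_bound:
  fixes f :: "real^2 \<Rightarrow> complex"
  assumes "Lp_norm lebesgue \<infinity> f < \<infinity>"
  shows "AE x in lborel. norm (f x) \<le> enn2real (Lp_norm lebesgue \<infinity> f)"
proof -
  have "AE x in lborel. ennreal (norm (f x)) \<le> Lp_norm lebesgue \<infinity> f"
    using esssup_AE[of "\<lambda>x. ennreal (norm (f x))" lebesgue]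
    by (simp add: Lp_norm_def AE_completion_iff)
  then show ?thesis
    by eventually_elim (use assms in \<open>cases "Lp_norm lebesgue \<infinity> f"; auto\<close>)
qed

lemma Lp_space_representative:
  fixes f :: "real^2 \<Rightarrow> complex"
  assumes f: "f \<in> Lp_space lebesgue p" and p: "2 < p"
  obtains f' where "f' \<in> borel_measurable borel" "AE x in lborel. f x = f' x"
    "Lp_bound (1 / enn2real p) (\<lambda>x. norm (f' x)) (enn2real (Lp_norm lebesgue p f))"
proof (cases "p = \<infinity>")
  case True
  have "f \<in> borel_measurable lebesgue" "Lp_norm lebesgue \<infinity> f < \<infinity>"
    using f True by (auto simp: Lp_space_def)
  then obtain f' where "f' \<in> borel_measurable borel" "AE x in lborel. f x = f' x"
      "\<And>x. norm (f' x) \<le> enn2real (Lp_norm lebesgue \<infinity> f)"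
    using bounded_Borel_representative[OF _ esssup_bound] by (metis enn2real_nonneg)
  then show ?thesis
    using that True by (auto simp: Lp_bound_def)
next
  case False
  have m: "f \<in> borel_measurable lebesgue" and fin: "Lp_norm lebesgue p f < \<infinity>"
    using f by (auto simp: Lp_space_def)
  obtain f' where f': "f' \<in> borel_measurable borel" "AE x in lborel. f x = f' x"
    using Borel_representative[OF m] .
  define P where "P = enn2real p"
  have P: "0 < P"
    using p False by (cases p) (auto simp: P_def)
  define I where "I = (\<integral>\<^sup>+x. ennreal (norm (f x) powr P) \<partial>lebesgue)"
  have norm: "Lp_norm lebesgue p f = epowr I (1 / P)"
    using False by (simp add: Lp_norm_def I_def P_def)
  have "I = (\<integral>\<^sup>+x. ennreal (norm (f' x) powr P) \<partial>lborel)"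
    unfolding I_def nn_integral_completion
    by (rule nn_integral_cong_AE) (use f'(2) in eventually_elim, simp)
  moreover obtain i where i: "I = ennreal i" "0 \<le> i"
    using fin norm by (cases I) (auto simp: epowr_def)
  moreover have "enn2real (Lp_norm lebesgue p f) powr P = i"
    unfolding norm using i P by (simp add: epowr_def powr_powr)
  ultimately have "Lp_bound (1 / P) (\<lambda>x. norm (f' x)) (enn2real (Lp_norm lebesgue p f))"
    using P by (simp add: Lp_bound_def)
  with f' show ?thesis
    using that by (simp add: P_def)
qed

text \<open>Covers the degenerate case of Hoelder's inequality in which a function has norm 0 and
  cannot be normalised.\<close>

lemma AE_zero_chord:
  assumes [measurable]: "F \<in> borel_measurable borel" and "\<And>x. 0 \<le> F x" and "q \<noteq> 0"
    and "Lp_bound q F 0" "0 < chord_sq t"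
  shows "AE x in lborel. F (chord t x) = 0"
proof -
  have "(\<integral>\<^sup>+x. ennreal (F (chord t x) powr (1 / q)) \<partial>lborel) = 0"
    using assms by (subst nn_integral_chord) (auto simp: Lp_bound_def)
  then have "AE x in lborel. ennreal (F (chord t x) powr (1 / q)) = 0"
    by (subst (asm) nn_integral_0_iff_AE) auto
  then show ?thesis
    by eventually_elim (use assms(2) in \<open>simp add: ennreal_eq_0_iff powr_nonneg_iff\<close>)
qed

lemma nn_integral_chord_powr_le:
  assumes [measurable]: "F \<in> borel_measurable borel"
    and "q \<noteq> 0" "Lp_bound q F n" "0 < chord_sq t"
  shows "(\<integral>\<^sup>+x. ennreal (F (chord t x) powr (1 / q)) \<partial>lborel) \<le> ennreal (n powr (1 / q) / chord_sq t)"
proof -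
  have "(\<integral>\<^sup>+x. ennreal (F (chord t x) powr (1 / q)) \<partial>lborel)
      = (\<integral>\<^sup>+x. ennreal (F x powr (1 / q)) \<partial>lborel) / ennreal (chord_sq t)"
    using assms by (subst nn_integral_chord) auto
  also have "\<dots> \<le> ennreal (n powr (1 / q)) / ennreal (chord_sq t)"
    using assms by (intro divide_right_mono_ennreal) (simp add: Lp_bound_def)
  finally show ?thesis
    using assms by (simp add: divide_ennreal)
qed

text \<open>Hoelder's inequality combined with the change of variables for both factors. In the main
  case it is Young's inequality with weights p * q1 and p * q2, which sum to 1; q2 = 0 uses the
  pointwise bound on \<open>G\<close> instead.\<close>

lemma slice_Hoelder:
  assumes F[measurable]: "F \<in> borel_measurable borel" and F0: "\<And>x. 0 \<le> F x" and Fn: "Lp_bound q1 F n1"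
    and G[measurable]: "G \<in> borel_measurable borel" and G0: "\<And>x. 0 \<le> G x" and Gn: "Lp_bound q2 G n2"
    and n: "0 \<le> n1" "0 \<le> n2" and q: "0 < q1" "0 \<le> q2" and p: "p = 1 / (q1 + q2)"
    and D: "0 < chord_sq t" "0 < chord_sq u"
  shows "(\<integral>\<^sup>+x. ennreal ((F (chord t x) * G (chord u x)) powr p) \<partial>lborel)
    \<le> ennreal ((chord_sq t powr - q1 * chord_sq u powr - q2) powr p * (n1 * n2) powr p)"
proof -
  have p0: "0 < p" using p q by simp
  consider "q2 = 0" | "q2 \<noteq> 0" "n1 = 0 \<or> n2 = 0" | "0 < q2" "0 < n1" "0 < n2"
    using n q by linarith
  then show ?thesis
  proof cases
    case 1
    have p1: "p = 1 / q1" using 1 p by simp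
    have "(\<integral>\<^sup>+x. ennreal ((F (chord t x) * G (chord u x)) powr p) \<partial>lborel)
        \<le> (\<integral>\<^sup>+x. ennreal (n2 powr p) * ennreal (F (chord t x) powr (1 / q1)) \<partial>lborel)"
    proof (rule nn_integral_mono)
      fix x
      have "G (chord u x) \<le> n2"
        using Gn 1 by (simp add: Lp_bound_def)
      then have "F (chord t x) * G (chord u x) \<le> n2 * F (chord t x)"
        using F0 by (subst mult.commute) (rule mult_right_mono)
      then have "(F (chord t x) * G (chord u x)) powr p \<le> (n2 * F (chord t x)) powr p"
        using F0 G0 p0 by (intro powr_mono2) auto
      also have "\<dots> = n2 powr p * F (chord t x) powr (1 / q1)"
        using n F0 p1 by (simp add: powr_mult)
      finally show "ennreal ((F (chord t x) * G (chord u x)) powr p)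
          \<le> ennreal (n2 powr p) * ennreal (F (chord t x) powr (1 / q1))"
        by (simp add: ennreal_mult[symmetric] ennreal_leI)
    qed
    also have "\<dots> = ennreal (n2 powr p) * (\<integral>\<^sup>+x. ennreal (F (chord t x) powr (1 / q1)) \<partial>lborel)"
      by (rule nn_integral_cmult) measurable
    also have "\<dots> \<le> ennreal (n2 powr p) * ennreal (n1 powr (1 / q1) / chord_sq t)"
      using q D Fn by (intro mult_left_mono nn_integral_chord_powr_le) auto
    also have "\<dots> = ennreal (n2 powr p * (n1 powr (1 / q1) / chord_sq t))"
      using D by (intro ennreal_mult[symmetric]) auto
    also have "n2 powr p * (n1 powr (1 / q1) / chord_sq t)
        = (chord_sq t powr - q1 * chord_sq u powr - q2) powr p * (n1 * n2) powr p"
    proof -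
      have "(chord_sq t powr - q1) powr p = inverse (chord_sq t)"
        unfolding powr_powr using D q by (simp add: p1 powr_minus)
      then show ?thesis
        unfolding p1[symmetric] using 1 D n by (simp add: powr_mult divide_inverse)
    qed
    finally show ?thesis .
  next
    case 2
    have "AE x in lborel. F (chord t x) * G (chord u x) = 0"
    proof (cases "n1 = 0")
      case True
      have "AE x in lborel. F (chord t x) = 0"
        by (rule AE_zero_chord[OF F F0, of q1]) (use True Fn q D in auto)
      then show ?thesis by eventually_elim simp
    next
      case False
      have "AE x in lborel. G (chord u x) = 0"
        by (rule AE_zero_chord[OF G G0, of q2]) (use False Gn 2 D in auto)
      then show ?thesis by eventually_elim simp
    qed
    then have "AE x in lborel. ennreal ((F (chord t x) * G (chord u x)) powr p) = 0"
      by eventually_elim (use p0 in simp)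
    then have "(\<integral>\<^sup>+x. ennreal ((F (chord t x) * G (chord u x)) powr p) \<partial>lborel) = 0"
      by (subst nn_integral_0_iff_AE) auto
    then show ?thesis by simp
  next
    case 3
    \<comment> \<open>Normalised by the bound n1^(1/q1) / \<open>chord_sq t\<close> on the integral
      of the power, so that \<open>a\<close> has integral at most 1; likewise
      \<open>b\<close>.\<close>
    define a where "a x = F (chord t x) powr (1 / q1) * (chord_sq t / n1 powr (1 / q1))" for x
    define b where "b x = G (chord u x) powr (1 / q2) * (chord_sq u / n2 powr (1 / q2))" for x
    define L where "L = (chord_sq t powr - q1 * chord_sq u powr - q2) powr p * (n1 * n2) powr p"
    have L0: "0 \<le> L" by (simp add: L_def)
    have pq: "0 \<le> p * q1" "0 \<le> p * q2" "p * q1 + p * q2 = 1"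
    proof -
      show "0 \<le> p * q1" "0 \<le> p * q2"
        using p0 q by simp_all
      have "p * q1 + p * q2 = p * (q1 + q2)"
        by (simp add: distrib_left)
      also have "\<dots> = 1"
        using p q by simp
      finally show "p * q1 + p * q2 = 1" .
    qed
    have ab0: "0 \<le> a x" "0 \<le> b x" for x
      using D by (auto simp: a_def b_def)
    have [measurable]: "a \<in> borel_measurable borel" "b \<in> borel_measurable borel"
      unfolding a_def[abs_def] b_def[abs_def] by measurable
    have point: "(F (chord t x) * G (chord u x)) powr p \<le> L * (p * q1 * a x + p * q2 * b x)" for x
    proof (cases "F (chord t x) = 0 \<or> G (chord u x) = 0")
      case True
      then show ?thesis using L0 pq ab0[of x] p0 by (auto intro!: mult_nonneg_nonneg add_nonneg_nonneg)
    next
      case False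
      then have FG: "0 < F (chord t x)" "0 < G (chord u x)"
        using F0 G0 by (simp_all add: less_le)
      then have ab: "0 < a x" "0 < b x"
        using D 3 by (auto simp: a_def b_def)
      have "a x powr (p * q1) = F (chord t x) powr p * (chord_sq t powr (p * q1) / n1 powr p)"
        using FG D 3 q by (simp add: a_def powr_mult powr_divide powr_powr)
      moreover have "b x powr (p * q2) = G (chord u x) powr p * (chord_sq u powr (p * q2) / n2 powr p)"
        using FG D 3 q by (simp add: b_def powr_mult powr_divide powr_powr)
      moreover have "L = chord_sq t powr - (p * q1) * chord_sq u powr - (p * q2) * n1 powr p * n2 powr p"
        using D 3 by (simp add: L_def powr_mult powr_powr mult_ac)
      \<comment> \<open>The cancellation is stated for arbitrary reals, so that the powers enter
        only as atoms.\<close>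
      moreover have "(A * B * N1 * N2) * ((f * (A' / N1)) * (g * (B' / N2))) = (A * A') * (B * B') * (f * g)"
        if "N1 \<noteq> 0" "N2 \<noteq> 0" for A B N1 N2 A' B' f g :: real
        using that by simp
      moreover have "chord_sq t powr - (p * q1) * chord_sq t powr (p * q1) = 1"
        "chord_sq u powr - (p * q2) * chord_sq u powr (p * q2) = 1" "n1 powr p \<noteq> 0" "n2 powr p \<noteq> 0"
        using D 3 by (simp_all add: powr_add[symmetric])
      ultimately have "L * (a x powr (p * q1) * b x powr (p * q2)) = F (chord t x) powr p * G (chord u x) powr p"
        by (simp only: mult_1_left not_False_eq_True)
      also have "\<dots> = (F (chord t x) * G (chord u x)) powr p"
        using FG by (simp add: powr_mult)
      finally have "(F (chord t x) * G (chord u x)) powr p = L * (a x powr (p * q1) * b x powr (p * q2))" ..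
      also have "\<dots> \<le> L * (p * q1 * a x + p * q2 * b x)"
        using L0 by (intro mult_left_mono Youngs_inequality_0 pq ab)
      finally show ?thesis .
    qed
    have ia: "(\<integral>\<^sup>+x. ennreal (a x) \<partial>lborel) \<le> 1"
    proof -
      have "(\<integral>\<^sup>+x. ennreal (a x) \<partial>lborel)
          = (\<integral>\<^sup>+x. ennreal (F (chord t x) powr (1 / q1)) \<partial>lborel) * ennreal (chord_sq t / n1 powr (1 / q1))"
        unfolding a_def using D by (simp add: ennreal_mult nn_integral_multc del: times_divide_eq_right)
      also have "\<dots> \<le> ennreal (n1 powr (1 / q1) / chord_sq t) * ennreal (chord_sq t / n1 powr (1 / q1))"
        using q D Fn by (intro mult_right_mono nn_integral_chord_powr_le) auto
      also have "\<dots> = 1"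
        using D 3 by (simp add: ennreal_mult[symmetric])
      finally show ?thesis .
    qed
    have ib: "(\<integral>\<^sup>+x. ennreal (b x) \<partial>lborel) \<le> 1"
    proof -
      have "(\<integral>\<^sup>+x. ennreal (b x) \<partial>lborel)
          = (\<integral>\<^sup>+x. ennreal (G (chord u x) powr (1 / q2)) \<partial>lborel) * ennreal (chord_sq u / n2 powr (1 / q2))"
        unfolding b_def using D by (simp add: ennreal_mult nn_integral_multc del: times_divide_eq_right)
      also have "\<dots> \<le> ennreal (n2 powr (1 / q2) / chord_sq u) * ennreal (chord_sq u / n2 powr (1 / q2))"
        using 3 D Gn by (intro mult_right_mono nn_integral_chord_powr_le) auto
      also have "\<dots> = 1"
        using D 3 by (simp add: ennreal_mult[symmetric])
      finally show ?thesis .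
    qed
    have "(\<integral>\<^sup>+x. ennreal ((F (chord t x) * G (chord u x)) powr p) \<partial>lborel)
        \<le> (\<integral>\<^sup>+x. ennreal L * (ennreal (p * q1) * ennreal (a x) + ennreal (p * q2) * ennreal (b x)) \<partial>lborel)"
    proof (rule nn_integral_mono)
      fix x
      have "ennreal ((F (chord t x) * G (chord u x)) powr p) \<le> ennreal (L * (p * q1 * a x + p * q2 * b x))"
        by (intro ennreal_leI point)
      also have "\<dots> = ennreal L * (ennreal (p * q1) * ennreal (a x) + ennreal (p * q2) * ennreal (b x))"
      proof -
        have "ennreal (p * q1 * a x + p * q2 * b x) = ennreal (p * q1) * ennreal (a x) + ennreal (p * q2) * ennreal (b x)"
          using pq ab0[of x] by (subst ennreal_plus) (simp_all add: ennreal_mult')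
        then show ?thesis
          using L0 by (simp only: ennreal_mult')
      qed
      finally show "ennreal ((F (chord t x) * G (chord u x)) powr p)
          \<le> ennreal L * (ennreal (p * q1) * ennreal (a x) + ennreal (p * q2) * ennreal (b x))" .
    qed
    also have "\<dots> = ennreal L * (ennreal (p * q1) * (\<integral>\<^sup>+x. ennreal (a x) \<partial>lborel) + ennreal (p * q2) * (\<integral>\<^sup>+x. ennreal (b x) \<partial>lborel))"
      by (simp add: nn_integral_cmult nn_integral_add)
    also have "\<dots> \<le> ennreal L * (ennreal (p * q1) * 1 + ennreal (p * q2) * 1)"
      by (intro mult_left_mono add_mono ia ib) auto
    also have "ennreal (p * q1) * 1 + ennreal (p * q2) * 1 = 1"
      using pq by (simp flip: ennreal_plus)
    finally show ?thesis
      by (simp add: L_def)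
  qed
qed

text \<open>At each \<open>t\<close> one Jacobian is at least \<open>c\<close>, so its negative
  power is bounded, and the other factor is integrable on its own. Positivity of \<open>W\<close> is
  required by Minkowski's inequality, where one divides by it.\<close>

lemma chord_weight_integral:
  assumes \<theta>: "0 < \<theta>" "\<theta> < 2 * pi" and q: "0 \<le> q1" "q1 < 1 / 2" "0 \<le> q2" "q2 < 1 / 2"
  obtains W where "0 < W"
    "(\<integral>\<^sup>+t. ennreal (chord_sq t powr - q1 * chord_sq (t + \<theta>) powr - q2) \<partial>angle_measure) = ennreal W"
proof -
  let ?w = "\<lambda>t. chord_sq t powr - q1 * chord_sq (t + \<theta>) powr - q2"
  define c where "c = chord_sq \<theta> / 4"
  have c: "0 < c" using chord_sq_gt_0[OF \<theta>] by (simp add: c_def)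
  have pos: "AE t in angle_measure. 0 < chord_sq (t + \<theta>)"
    using \<theta> by (intro AE_chord_sq_shift_pos) auto
  have "(\<integral>\<^sup>+t. ennreal (?w t) \<partial>angle_measure)
      \<le> (\<integral>\<^sup>+t. ennreal (c powr - q1) * ennreal (chord_sq (t + \<theta>) powr - q2)
           + ennreal (c powr - q2) * ennreal (chord_sq t powr - q1) \<partial>angle_measure)"
  proof (rule nn_integral_mono_AE)
    show "AE t in angle_measure. ennreal (?w t) \<le> ennreal (c powr - q1) * ennreal (chord_sq (t + \<theta>) powr - q2)
           + ennreal (c powr - q2) * ennreal (chord_sq t powr - q1)"
      using AE_chord_sq_pos pos
    proof eventually_elim
      case (elim t)
      have "c \<le> chord_sq t \<or> c \<le> chord_sq (t + \<theta>)"
        using chord_sq_sum_ge[of \<theta> t] unfolding c_def by argo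
      then have "?w t \<le> c powr - q1 * chord_sq (t + \<theta>) powr - q2 \<or> ?w t \<le> c powr - q2 * chord_sq t powr - q1"
      proof (elim disjE)
        assume "c \<le> chord_sq t"
        then have "chord_sq t powr - q1 \<le> c powr - q1"
          using c q by (intro powr_mono2') auto
        then show ?thesis
          by (intro disjI1 mult_right_mono) auto
      next
        assume "c \<le> chord_sq (t + \<theta>)"
        then have "chord_sq (t + \<theta>) powr - q2 \<le> c powr - q2"
          using c q by (intro powr_mono2') auto
        then show ?thesis
          unfolding mult.commute[of "chord_sq t powr - q1"] by (intro disjI2 mult_right_mono) auto
      qed
      then have "?w t \<le> c powr - q1 * chord_sq (t + \<theta>) powr - q2 + c powr - q2 * chord_sq t powr - q1"
        by (elim disjE) (erule order.trans, simp)+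
      then have "ennreal (?w t) \<le> ennreal (c powr - q1 * chord_sq (t + \<theta>) powr - q2 + c powr - q2 * chord_sq t powr - q1)"
        by (rule ennreal_leI)
      then show ?case
        by (simp add: ennreal_mult)
    qed
  qed
  also have "\<dots> = ennreal (c powr - q1) * (\<integral>\<^sup>+t. ennreal (chord_sq (t + \<theta>) powr - q2) \<partial>angle_measure)
           + ennreal (c powr - q2) * (\<integral>\<^sup>+t. ennreal (chord_sq t powr - q1) \<partial>angle_measure)"
    by (subst nn_integral_add) (simp_all add: nn_integral_cmult)
  also have "(\<integral>\<^sup>+t. ennreal (chord_sq (t + \<theta>) powr - q2) \<partial>angle_measure)
      = (\<integral>\<^sup>+t. ennreal (chord_sq t powr - q2) \<partial>angle_measure)"
    using \<theta> by (intro nn_integral_angle_shift) (auto simp: chord_sq_periodic)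
  also have "ennreal (c powr - q1) * (\<integral>\<^sup>+t. ennreal (chord_sq t powr - q2) \<partial>angle_measure)
           + ennreal (c powr - q2) * (\<integral>\<^sup>+t. ennreal (chord_sq t powr - q1) \<partial>angle_measure) < \<infinity>"
    using nn_integral_chord_sq_powr_finite[of q1] nn_integral_chord_sq_powr_finite[of q2] q
    by (simp add: ennreal_mult_less_top)
  finally obtain W where W: "(\<integral>\<^sup>+t. ennreal (?w t) \<partial>angle_measure) = ennreal W" "0 \<le> W"
    by (cases "\<integral>\<^sup>+t. ennreal (?w t) \<partial>angle_measure") auto
  moreover have "W \<noteq> 0"
  proof
    assume "W = 0"
    with W have "(\<integral>\<^sup>+t. ennreal (?w t) \<partial>angle_measure) = 0"
      by simp
    then have "AE t in angle_measure. ennreal (?w t) = 0"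
      by (subst (asm) nn_integral_0_iff_AE) auto
    then have "AE t in angle_measure. False"
      using AE_chord_sq_pos pos by eventually_elim auto
    then have "emeasure angle_measure UNIV = 0"
      by (subst (asm) AE_iff_measurable[OF _ refl]) auto
    moreover have "emeasure angle_measure UNIV = ennreal (2 * pi)"
      unfolding angle_measure_def by (subst emeasure_density) auto
    ultimately show False by simp
  qed
  ultimately show thesis
    by (intro that[of W]) auto
qed

text \<open>Finiteness almost everywhere is a separate clause because \<open>enn2real\<close> sends
  \<infinity> to 0, so the norm bound alone would not detect an infinite average.\<close>

definition bilin_avg_Lp_bound :: "real \<Rightarrow> real \<Rightarrow> real \<Rightarrow> real \<Rightarrow> bool" where
  "bilin_avg_Lp_bound \<theta> q1 q2 C \<longleftrightarrow> 0 \<le> C \<and>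
     (\<forall>F G n1 n2. F \<in> borel_measurable borel \<and> (\<forall>x. 0 \<le> F x) \<and> Lp_bound q1 F n1 \<and>
        G \<in> borel_measurable borel \<and> (\<forall>x. 0 \<le> G x) \<and> Lp_bound q2 G n2 \<and> 0 \<le> n1 \<and> 0 \<le> n2 \<longrightarrow>
        (let A = bilin_avg \<theta> (\<lambda>x. ennreal (F x)) (\<lambda>x. ennreal (G x))
         in (AE x in lborel. A x < \<infinity>) \<and> Lp_bound (q1 + q2) (\<lambda>x. enn2real (A x)) (C * n1 * n2)))"

lemma bilin_avg_Lp_boundI:
  assumes "0 \<le> C"
    and "\<And>F G n1 n2 A. F \<in> borel_measurable borel \<Longrightarrow> (\<And>x. 0 \<le> F x) \<Longrightarrow> Lp_bound q1 F n1 \<Longrightarrow>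
        G \<in> borel_measurable borel \<Longrightarrow> (\<And>x. 0 \<le> G x) \<Longrightarrow> Lp_bound q2 G n2 \<Longrightarrow> 0 \<le> n1 \<Longrightarrow> 0 \<le> n2 \<Longrightarrow>
        A = bilin_avg \<theta> (\<lambda>x. ennreal (F x)) (\<lambda>x. ennreal (G x)) \<Longrightarrow>
        (AE x in lborel. A x < \<infinity>) \<and> Lp_bound (q1 + q2) (\<lambda>x. enn2real (A x)) (C * n1 * n2)"
  shows "bilin_avg_Lp_bound \<theta> q1 q2 C"
  using assms unfolding bilin_avg_Lp_bound_def Let_def by blast

lemma bilin_avg_Lp_boundD:
  assumes "bilin_avg_Lp_bound \<theta> q1 q2 C" "F \<in> borel_measurable borel" "\<And>x. 0 \<le> F x" "Lp_bound q1 F n1"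
    "G \<in> borel_measurable borel" "\<And>x. 0 \<le> G x" "Lp_bound q2 G n2" "0 \<le> n1" "0 \<le> n2"
  shows "AE x in lborel. bilin_avg \<theta> (\<lambda>x. ennreal (F x)) (\<lambda>x. ennreal (G x)) x < \<infinity>"
    and "Lp_bound (q1 + q2) (\<lambda>x. enn2real (bilin_avg \<theta> (\<lambda>x. ennreal (F x)) (\<lambda>x. ennreal (G x)) x)) (C * n1 * n2)"
  using assms unfolding bilin_avg_Lp_bound_def Let_def by blast+

lemma bilin_avg_Lp_bound_commute:
  assumes "bilin_avg_Lp_bound (2 * pi - \<theta>) q2 q1 C" and \<theta>: "0 \<le> \<theta>" "\<theta> \<le> 2 * pi"
  shows "bilin_avg_Lp_bound \<theta> q1 q2 C"
proof (rule bilin_avg_Lp_boundI)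
  show "0 \<le> C"
    using assms(1) by (simp add: bilin_avg_Lp_bound_def)
  fix F G :: "real^2 \<Rightarrow> real" and n1 n2 :: real and A
  assume F[measurable]: "F \<in> borel_measurable borel" and F0: "\<And>x. 0 \<le> F x" and Fn: "Lp_bound q1 F n1"
    and G[measurable]: "G \<in> borel_measurable borel" and G0: "\<And>x. 0 \<le> G x" and Gn: "Lp_bound q2 G n2"
    and n: "0 \<le> n1" "0 \<le> n2" and A: "A = bilin_avg \<theta> (\<lambda>x. ennreal (F x)) (\<lambda>x. ennreal (G x))"
  have "A = bilin_avg (2 * pi - \<theta>) (\<lambda>x. ennreal (G x)) (\<lambda>x. ennreal (F x))"
    unfolding A using \<theta> by (intro bilin_avg_swap) auto
  then show "(AE x in lborel. A x < \<infinity>) \<and> Lp_bound (q1 + q2) (\<lambda>x. enn2real (A x)) (C * n1 * n2)"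
    using bilin_avg_Lp_boundD[OF assms(1) G G0 Gn F F0 Fn n(2,1)]
    by (simp add: add.commute[of q1] mult.assoc mult.commute[of n1])
qed

text \<open>The exponents satisfy 0 < q1 + q2 < 1, so the target exponent \<open>p\<close> is finite
  and exceeds 1. The total weight \<open>W\<close> is the resulting constant.\<close>

lemma bilin_avg_Lp_pos:
  assumes \<theta>: "0 < \<theta>" "\<theta> < 2 * pi" and q: "0 < q1" "q1 < 1 / 2" "0 \<le> q2" "q2 < 1 / 2"
  shows "\<exists>C. bilin_avg_Lp_bound \<theta> q1 q2 C"
proof -
  define w where "w t = chord_sq t powr - q1 * chord_sq (t + \<theta>) powr - q2" for t
  obtain W where W: "0 < W" "(\<integral>\<^sup>+t. ennreal (w t) \<partial>angle_measure) = ennreal W"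
    unfolding w_def using chord_weight_integral[OF \<theta>, of q1 q2] q by (metis less_imp_le)
  have pos: "AE t in angle_measure. 0 < chord_sq (t + \<theta>)"
    using \<theta> by (intro AE_chord_sq_shift_pos) auto
  define p where "p = 1 / (q1 + q2)"
  have p: "1 < p" using q by (simp add: p_def)
  show ?thesis
  proof (intro exI bilin_avg_Lp_boundI)
    show "0 \<le> W" using W by simp
    fix F G :: "real^2 \<Rightarrow> real" and n1 n2 :: real and A
    assume F[measurable]: "F \<in> borel_measurable borel" and F0: "\<And>x. 0 \<le> F x" and Fn: "Lp_bound q1 F n1"
      and G[measurable]: "G \<in> borel_measurable borel" and G0: "\<And>x. 0 \<le> G x" and Gn: "Lp_bound q2 G n2"
      and n: "0 \<le> n1" "0 \<le> n2" and A: "A = bilin_avg \<theta> (\<lambda>x. ennreal (F x)) (\<lambda>x. ennreal (G x))"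
    define H where "H x t = F (chord t x) * G (chord (t + \<theta>) x)" for x t
    have H: "A x = (\<integral>\<^sup>+t. ennreal (H x t) \<partial>angle_measure)" for x
      using F0 G0 by (simp add: A bilin_avg_def H_def ennreal_mult)
    have Hm: "(\<lambda>(x, t). H x t) \<in> borel_measurable (lborel \<Otimes>\<^sub>M angle_measure)"
      unfolding H_def by measurable
    have H0: "0 \<le> H x t" for x t
      using F0 G0 by (simp add: H_def)
    have wm: "w \<in> borel_measurable angle_measure"
      unfolding w_def[abs_def] by measurable
    have w0: "AE t in angle_measure. 0 < w t"
      using AE_chord_sq_pos pos by eventually_elim (simp add: w_def)
    have slice: "AE t in angle_measure. (\<integral>\<^sup>+x. ennreal (H x t powr p) \<partial>lborel) \<le> ennreal (w t powr p * (n1 * n2) powr p)"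
      using AE_chord_sq_pos pos unfolding H_def w_def
      by eventually_elim (use q in \<open>intro slice_Hoelder[OF F F0 Fn G G0 Gn n] p_def\<close>, auto)
    note Mink = lborel_angle.Minkowski_weighted[OF Hm H0 wm w0 W(2,1) p _ slice]
    have "W powr p * (n1 * n2) powr p = (W * n1 * n2) powr p"
      using W n by (simp add: powr_mult mult.assoc)
    with Mink show "(AE x in lborel. A x < \<infinity>) \<and> Lp_bound (q1 + q2) (\<lambda>x. enn2real (A x)) (W * n1 * n2)"
      unfolding H Lp_bound_def using q by (simp add: p_def)
  qed
qed

lemma bilin_avg_bounded:
  assumes "\<And>x. 0 \<le> F x" "\<And>x. F x \<le> n1" "\<And>x. 0 \<le> G x" "\<And>x. G x \<le> n2"
  shows "bilin_avg \<theta> (\<lambda>x. ennreal (F x)) (\<lambda>x. ennreal (G x)) x \<le> ennreal (2 * pi * n1 * n2)"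
proof -
  have n: "0 \<le> n1" "0 \<le> n2"
    using assms order.trans by blast+
  have "bilin_avg \<theta> (\<lambda>x. ennreal (F x)) (\<lambda>x. ennreal (G x)) x \<le> (\<integral>\<^sup>+t. ennreal (n1 * n2) \<partial>angle_measure)"
    unfolding bilin_avg_def
  proof (rule nn_integral_mono)
    fix t
    have "ennreal (F (chord t x)) * ennreal (G (chord (t + \<theta>) x)) \<le> ennreal n1 * ennreal n2"
      using assms by (intro mult_mono ennreal_leI) auto
    then show "ennreal (F (chord t x)) * ennreal (G (chord (t + \<theta>) x)) \<le> ennreal (n1 * n2)"
      using n by (simp add: ennreal_mult)
  qed
  also have "\<dots> = ennreal (n1 * n2) * emeasure angle_measure UNIV"
    by simp
  also have "emeasure angle_measure UNIV = ennreal (2 * pi)"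
    unfolding angle_measure_def by (subst emeasure_density) auto
  finally show ?thesis
    using n by (simp add: ennreal_mult[symmetric] mult_ac)
qed

lemma bilin_avg_Lp:
  assumes \<theta>: "0 < \<theta>" "\<theta> < 2 * pi" and q: "0 \<le> q1" "q1 < 1 / 2" "0 \<le> q2" "q2 < 1 / 2"
  shows "\<exists>C. bilin_avg_Lp_bound \<theta> q1 q2 C"
proof -
  consider "0 < q1" | "q1 = 0" "0 < q2" | "q1 = 0" "q2 = 0"
    using q by linarith
  then show ?thesis
  proof cases
    case 1
    then show ?thesis
      using bilin_avg_Lp_pos[OF \<theta>] q by blast
  next
    case 2
    obtain C where "bilin_avg_Lp_bound (2 * pi - \<theta>) q2 q1 C"
      using bilin_avg_Lp_pos[of "2 * pi - \<theta>" q2 q1] \<theta> q 2 by auto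
    then have "bilin_avg_Lp_bound \<theta> q1 q2 C"
      by (rule bilin_avg_Lp_bound_commute) (use \<theta> in auto)
    then show ?thesis ..
  next
    case 3
    show ?thesis
    proof (intro exI bilin_avg_Lp_boundI)
      show "0 \<le> 2 * pi" by simp
      fix F G :: "real^2 \<Rightarrow> real" and n1 n2 :: real and A
      assume "\<And>x. 0 \<le> F x" "Lp_bound q1 F n1" "\<And>x. 0 \<le> G x" "Lp_bound q2 G n2" and n: "0 \<le> n1" "0 \<le> n2"
        and "A = bilin_avg \<theta> (\<lambda>x. ennreal (F x)) (\<lambda>x. ennreal (G x))"
      then have le: "A x \<le> ennreal (2 * pi * n1 * n2)" for x
        using 3 bilin_avg_bounded[of F n1 G n2] by (simp add: Lp_bound_def)
      have "enn2real (A x) \<le> 2 * pi * n1 * n2" for x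
        using enn2real_mono[OF le[of x]] n by simp
      moreover have "A x < \<infinity>" for x
        using le[of x] by (rule le_less_trans) simp
      ultimately show "(AE x in lborel. A x < \<infinity>) \<and> Lp_bound (q1 + q2) (\<lambda>x. enn2real (A x)) (2 * pi * n1 * n2)"
        using 3 by (simp add: Lp_bound_def)
    qed
  qed
qed

lemma Lp_norm_le_of_bound:
  fixes h :: "real^2 \<Rightarrow> complex"
  assumes h: "h \<in> borel_measurable lebesgue" and p: "p \<noteq> 0"
    and le: "AE x in lborel. norm (h x) \<le> F x" and F0: "\<And>x. 0 \<le> F x"
    and F: "Lp_bound (1 / enn2real p) F n" and n: "0 \<le> n"
  shows "Lp_norm lebesgue p h \<le> ennreal n"
proof (cases "p = \<infinity>")
  case True
  then have Fn: "F x \<le> n" for x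
    using F by (simp add: Lp_bound_def)
  have "AE x in lebesgue. ennreal (norm (h x)) \<le> ennreal n"
    using AE_completion[OF le] by eventually_elim (rule ennreal_leI, erule order.trans, rule Fn)
  then show ?thesis
    using True h by (simp add: Lp_norm_def esssup_I)
next
  case False
  define P where "P = enn2real p"
  have P: "0 < P" using False p by (cases p) (auto simp: P_def less_le)
  define I where "I = (\<integral>\<^sup>+x. ennreal (norm (h x) powr P) \<partial>lebesgue)"
  have "I \<le> (\<integral>\<^sup>+x. ennreal (F x powr P) \<partial>lborel)"
    unfolding I_def nn_integral_completion
  proof (rule nn_integral_mono_AE)
    show "AE x in lborel. ennreal (norm (h x) powr P) \<le> ennreal (F x powr P)"
      using le by eventually_elim (use P in \<open>auto intro!: ennreal_leI powr_mono2\<close>)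
  qed
  also have "\<dots> \<le> ennreal (n powr P)"
    using F P by (simp add: Lp_bound_def P_def)
  finally have I: "I \<le> ennreal (n powr P)" .
  then obtain i where i: "I = ennreal i" "0 \<le> i"
    by (cases I) (auto simp: top_unique)
  with I have "i \<le> n powr P" by simp
  then have "i powr (1 / P) \<le> (n powr P) powr (1 / P)"
    using i P by (intro powr_mono2) auto
  also have "\<dots> = n"
    using n P by (simp add: powr_powr)
  finally have "epowr I (1 / P) \<le> ennreal n"
    using i by (simp add: epowr_ennreal ennreal_leI)
  then show ?thesis
    using False by (simp add: Lp_norm_def I_def P_def)
qed

text \<open>Also valid at \<infinity>, where \<open>enn2real\<close> gives 0 and real division by 0
  gives 0. Hence \<open>1 / enn2real p\<close> is the reciprocal exponent in all cases.\<close>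

lemma ennreal_inverse_exponent:
  assumes "0 < (p :: ennreal)"
  shows "1 / p = ennreal (1 / enn2real p)"
  using assms by (cases p) (auto simp: divide_ennreal simp flip: ennreal_1)

lemma exponent_sum:
  fixes p1 p2 p :: ennreal
  assumes "0 < p1" "0 < p2" and p: "1 / p1 + 1 / p2 = 1 / p"
  shows "p \<noteq> 0" "1 / enn2real p = 1 / enn2real p1 + 1 / enn2real p2"
proof -
  have eq: "1 / p = ennreal (1 / enn2real p1 + 1 / enn2real p2)"
    using assms by (simp add: ennreal_inverse_exponent flip: p)
  show "p \<noteq> 0"
  proof
    assume "p = 0"
    then have "1 / p = \<infinity>" by simp
    with eq show False by (simp del: ennreal_plus)
  qed
  then show "1 / enn2real p = 1 / enn2real p1 + 1 / enn2real p2"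
  proof -
    from \<open>p \<noteq> 0\<close> have "ennreal (1 / enn2real p) = ennreal (1 / enn2real p1 + 1 / enn2real p2)"
      using eq ennreal_inverse_exponent[of p] by (simp add: less_le del: ennreal_plus)
    then show ?thesis
      by (subst (asm) ennreal_inj) auto
  qed
qed

lemma exponent_less_half:
  assumes "2 < (p :: ennreal)"
  shows "0 \<le> 1 / enn2real p" "1 / enn2real p < 1 / 2"
proof -
  show "1 / enn2real p < 1 / 2"
  proof (cases p)
    case (real r)
    then have "2 < r"
      using assms by (simp flip: ennreal_numeral add: ennreal_less_iff)
    then show ?thesis using real by (simp add: field_simps)
  qed simp
qed simp

lemma circ_avg_strong:
  assumes \<theta>: "0 < \<theta>" "\<theta> < 2 * pi" and p12: "2 < p1" "2 < p2" and p: "1 / p1 + 1 / p2 = 1 / p"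
  shows "\<exists>C::real. 0 \<le> C \<and>
          (\<forall>f \<in> Lp_space lebesgue p1. \<forall>g \<in> Lp_space lebesgue p2.
             circ_avg_defined \<theta> f g \<and>
             circ_avg \<theta> f g \<in> Lp_space lebesgue p \<and>
             Lp_norm lebesgue p (circ_avg \<theta> f g)
               \<le> ennreal C * Lp_norm lebesgue p1 f * Lp_norm lebesgue p2 g)"
proof -
  have p0: "0 < p1" "0 < p2"
    using p12 by (auto intro: le_less_trans[rotated])
  obtain C where C: "bilin_avg_Lp_bound \<theta> (1 / enn2real p1) (1 / enn2real p2) C"
    using bilin_avg_Lp[OF \<theta> exponent_less_half[OF p12(1)] exponent_less_half[OF p12(2)]] ..
  then have C0: "0 \<le> C"
    by (simp add: bilin_avg_Lp_bound_def)
  show ?thesis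
  proof (intro exI[of _ C] conjI ballI C0)
    fix f g :: "real^2 \<Rightarrow> complex"
    assume f: "f \<in> Lp_space lebesgue p1" and g: "g \<in> Lp_space lebesgue p2"
    let ?n1 = "enn2real (Lp_norm lebesgue p1 f)" and ?n2 = "enn2real (Lp_norm lebesgue p2 g)"
    obtain f' where f'[measurable]: "f' \<in> borel_measurable borel" and ff: "AE x in lborel. f x = f' x"
      and fb: "Lp_bound (1 / enn2real p1) (\<lambda>x. norm (f' x)) ?n1"
      using Lp_space_representative[OF f p12(1)] by metis
    obtain g' where g'[measurable]: "g' \<in> borel_measurable borel" and gg: "AE x in lborel. g x = g' x"
      and gb: "Lp_bound (1 / enn2real p2) (\<lambda>x. norm (g' x)) ?n2"
      using Lp_space_representative[OF g p12(2)] by metis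
    have norm_m: "(\<lambda>x. norm (f' x)) \<in> borel_measurable borel" "(\<lambda>x. norm (g' x)) \<in> borel_measurable borel"
      by measurable
    define m where "m = bilin_avg \<theta> (\<lambda>x. ennreal (norm (f' x))) (\<lambda>x. ennreal (norm (g' x)))"
    note D = bilin_avg_Lp_boundD[OF C norm_m(1) norm_ge_zero fb norm_m(2) norm_ge_zero gb enn2real_nonneg enn2real_nonneg,
        folded m_def]
    have fin: "AE x in lborel. m x < \<infinity>"
      by (rule D)
    have mb: "Lp_bound (1 / enn2real p) (\<lambda>x. enn2real (m x)) (C * ?n1 * ?n2)"
      unfolding exponent_sum(2)[OF p0 p] by (rule D)
    have red: "circ_avg \<theta> f g \<in> borel_measurable lebesgue"
      "AE x in lborel. ennreal (norm (circ_avg \<theta> f g x)) \<le> m x"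
      "circ_avg_defined \<theta> f g"
      using circ_avg_reduction[OF _ _ f' g' ff gg, of \<theta>] \<theta> fin by (auto simp: m_def)
    show "circ_avg_defined \<theta> f g" by (rule red)
    have "AE x in lborel. norm (circ_avg \<theta> f g x) \<le> enn2real (m x)"
      using red(2) fin
    proof eventually_elim
      case (elim x)
      then show ?case
        using enn2real_mono[of "ennreal (norm (circ_avg \<theta> f g x))" "m x"] by simp
    qed
    then have le: "Lp_norm lebesgue p (circ_avg \<theta> f g) \<le> ennreal (C * ?n1 * ?n2)"
      using C0 by (intro Lp_norm_le_of_bound[OF red(1) exponent_sum(1)[OF p0 p] _ _ mb]) auto
    also have "\<dots> = ennreal C * Lp_norm lebesgue p1 f * Lp_norm lebesgue p2 g"
      using f g C0 by (simp add: Lp_space_def ennreal_mult)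
    finally show "Lp_norm lebesgue p (circ_avg \<theta> f g) \<le> ennreal C * Lp_norm lebesgue p1 f * Lp_norm lebesgue p2 g" .
    show "circ_avg \<theta> f g \<in> Lp_space lebesgue p"
      using red(1) le by (auto simp: Lp_space_def intro: le_less_trans)
  qed
qed

subsection \<open>The endpoint\<close>

lemma exponent_le_half:
  assumes "2 \<le> (p :: ennreal)"
  shows "0 \<le> 1 / enn2real p" "1 / enn2real p \<le> 1 / 2" "p \<noteq> \<infinity> \<Longrightarrow> 0 < enn2real p"
proof -
  have "p = \<infinity> \<or> 2 \<le> enn2real p"
  proof (cases p)
    case (real r)
    then show ?thesis
      using assms by (simp flip: ennreal_numeral)
  qed simp
  then show "1 / enn2real p \<le> 1 / 2" "p \<noteq> \<infinity> \<Longrightarrow> 0 < enn2real p"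
    by (auto simp: field_simps)
qed simp

text \<open>Treats finite and infinite exponents uniformly. For finite \<open>p\<close> the integral
  over levels carries the factor 1/p, which is at most 1; for \<infinity> the weight is the
  indicator below the essential supremum and integrates to it exactly.\<close>

lemma lorentz_space_representative:
  fixes g :: "real^2 \<Rightarrow> complex"
  assumes g: "g \<in> lorentz_space lebesgue p 1" and p: "2 \<le> p"
  obtains g' where "g' \<in> borel_measurable borel" "AE x in lborel. g x = g' x"
    "1 / enn2real p = 0 \<longrightarrow> (\<forall>x. norm (g' x) \<le> enn2real (lorentz_norm lebesgue p 1 g))"
    "(\<integral>\<^sup>+s. indicator {0..} s *
        superlevel_weight (\<lambda>x. norm (g' x)) (enn2real (lorentz_norm lebesgue p 1 g)) (1 / enn2real p) s \<partial>lborel)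
      \<le> lorentz_norm lebesgue p 1 g"
proof -
  have m: "g \<in> borel_measurable lebesgue" and fin: "lorentz_norm lebesgue p 1 g < \<infinity>"
    using g by (auto simp: lorentz_space_def)
  show thesis
  proof (cases "p = \<infinity>")
    case True
    then have norm: "lorentz_norm lebesgue p 1 g = Lp_norm lebesgue \<infinity> g"
      by (simp add: lorentz_norm_def)
    define c where "c = enn2real (Lp_norm lebesgue \<infinity> g)"
    have c: "0 \<le> c" "Lp_norm lebesgue \<infinity> g = ennreal c"
      using fin by (simp_all add: norm c_def)
    have "AE x in lborel. norm (g x) \<le> c"
      using esssup_bound[of g] fin by (simp add: norm c_def)
    then obtain g' where g': "g' \<in> borel_measurable borel" "AE x in lborel. g x = g' x" "\<And>x. norm (g' x) \<le> c"
      using bounded_Borel_representative[OF m _ c(1)] by blast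
    have "(\<integral>\<^sup>+s. indicator {0..} s * superlevel_weight (\<lambda>x. norm (g' x)) c 0 s \<partial>lborel)
        = (\<integral>\<^sup>+s. indicator {0..<c} s \<partial>lborel)"
      by (intro nn_integral_cong) (auto simp: superlevel_weight_def indicator_def)
    also have "\<dots> = ennreal c"
      using c by simp
    finally have "(\<integral>\<^sup>+s. indicator {0..} s * superlevel_weight (\<lambda>x. norm (g' x)) c 0 s \<partial>lborel) = ennreal c" .
    moreover have "lorentz_norm lebesgue p 1 g = ennreal c"
      by (simp only: norm c(2))
    moreover have "enn2real p = 0"
      using True by simp
    ultimately show thesis
      using g' c(1) by (intro that[of g']) simp_all
  next
    case False
    have P: "0 < enn2real p" "1 / enn2real p \<le> 1 / 2"
      using exponent_le_half[OF p] False by auto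
    obtain g' where g': "g' \<in> borel_measurable borel" "AE x in lborel. g x = g' x"
      using Borel_representative[OF m] .
    have "(\<integral>\<^sup>+s. indicator {0..} s * superlevel_weight (\<lambda>x. norm (g' x)) c (1 / enn2real p) s \<partial>lborel)
        \<le> lorentz_norm lebesgue p 1 g" for c
    proof -
      have "(\<integral>\<^sup>+s. indicator {0..} s * superlevel_weight (\<lambda>x. norm (g' x)) c (1 / enn2real p) s \<partial>lborel)
          = (\<integral>\<^sup>+s. indicator {0..} s * epowr (distr_fun lebesgue g (ennreal s)) (1 / enn2real p) \<partial>lborel)"
      proof (rule nn_integral_cong)
        fix s :: real
        show "indicator {0..} s * superlevel_weight (\<lambda>x. norm (g' x)) c (1 / enn2real p) s
            = indicator {0..} s * epowr (distr_fun lebesgue g (ennreal s)) (1 / enn2real p)"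
          using P distr_fun_lebesgue[OF m g', of s] by (simp add: superlevel_weight_def indicator_def)
      qed
      also have "\<dots> \<le> ennreal (1 / enn2real p) * lorentz_norm lebesgue p 1 g"
        using False P by (intro integral_distr_fun_le_lorentz_norm m borel_measurable_distr_fun_lebesgue[OF m g'])
      also have "\<dots> \<le> 1 * lorentz_norm lebesgue p 1 g"
        using P by (intro mult_right_mono) auto
      finally show ?thesis by simp
    qed
    then show thesis
      using g' P by (intro that[of g']) auto
  qed
qed

text \<open>The testing bound also yields existence of the average: its majorant \<open>m\<close>
  has finite integral over every ball, hence is finite almost everywhere.\<close>

lemma circ_avg_weak_of_bound:
  fixes p :: ennreal
  assumes \<theta>: "0 < \<theta>" "\<theta> < 2 * pi"
    and f': "f' \<in> borel_measurable borel" "AE x in lborel. f x = f' x"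
    and g': "g' \<in> borel_measurable borel" "AE x in lborel. g x = g' x"
    and p: "p \<noteq> \<infinity>" "0 < enn2real p" and K: "0 \<le> K"
    and bound: "weak_bound (bilin_avg \<theta> (\<lambda>x. ennreal (norm (f' x))) (\<lambda>x. ennreal (norm (g' x))))
      K (1 - 1 / enn2real p)"
  shows "circ_avg_defined \<theta> f g" "circ_avg \<theta> f g \<in> lorentz_space lebesgue p \<infinity>"
    "lorentz_norm lebesgue p \<infinity> (circ_avg \<theta> f g) \<le> ennreal K"
proof -
  define m where "m = bilin_avg \<theta> (\<lambda>x. ennreal (norm (f' x))) (\<lambda>x. ennreal (norm (g' x)))"
  note [measurable] = f'(1) g'(1)
  have m[measurable]: "m \<in> borel_measurable borel"
    unfolding m_def by measurable
  have "AE x in lborel. x \<in> ball 0 (real n) \<longrightarrow> m x \<noteq> \<infinity>" for n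
  proof -
    obtain b where b: "emeasure lborel (ball (0 :: real^2) (real n)) = ennreal b" "0 \<le> b"
      using emeasure_lborel_ball_finite[of "0 :: real^2" "real n"]
      by (cases "emeasure lborel (ball (0 :: real^2) (real n))") auto
    show ?thesis
    proof (cases "b = 0")
      case True
      then have "ball (0 :: real^2) (real n) \<in> null_sets lborel"
        using b by (auto simp: null_sets_def)
      then have "AE x in lborel. x \<notin> ball (0 :: real^2) (real n)"
        by (rule AE_not_in)
      then show ?thesis by eventually_elim simp
    next
      case False
      then have "(\<integral>\<^sup>+x. indicator (ball 0 (real n)) x * m x \<partial>lborel) \<le> ennreal (K * b powr (1 - 1 / enn2real p))"
        using bound b unfolding weak_bound_def m_def by auto
      then have "(\<integral>\<^sup>+x. indicator (ball 0 (real n)) x * m x \<partial>lborel) \<noteq> \<infinity>"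
        by (auto simp: top_unique)
      then have "AE x in lborel. indicator (ball 0 (real n)) x * m x \<noteq> \<infinity>"
        using m by (intro nn_integral_PInf_AE borel_measurable_times_ennreal borel_measurable_indicator) simp_all
      then show ?thesis
        by eventually_elim (auto simp: indicator_def)
    qed
  qed
  then have "AE x in lborel. \<forall>n. x \<in> ball 0 (real n) \<longrightarrow> m x \<noteq> \<infinity>"
    by (subst AE_all_countable) blast
  then have fin: "AE x in lborel. m x < \<infinity>"
  proof eventually_elim
    case (elim x)
    obtain n :: nat where "norm x < real n"
      using reals_Archimedean2 by blast
    with elim show ?case by (auto simp: less_top)
  qed
  have red: "circ_avg \<theta> f g \<in> borel_measurable lebesgue"
    "AE x in lborel. ennreal (norm (circ_avg \<theta> f g x)) \<le> m x" "circ_avg_defined \<theta> f g"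
    using circ_avg_reduction[OF _ _ f'(1) g'(1) f'(2) g'(2), of \<theta>] \<theta> fin by (auto simp: m_def)
  show "circ_avg_defined \<theta> f g" by (rule red)
  show le: "lorentz_norm lebesgue p \<infinity> (circ_avg \<theta> f g) \<le> ennreal K"
  proof (rule lorentz_norm_weak_le[OF p K])
    fix a :: real assume a: "0 < a"
    have "distr_fun lebesgue (circ_avg \<theta> f g) (ennreal a) \<le> ennreal ((K / a) powr (1 / (1 / enn2real p)))"
      using p K a bound unfolding m_def[symmetric]
      by (intro distr_fun_le_of_weak[OF red(1) m red(2)]) auto
    then show "distr_fun lebesgue (circ_avg \<theta> f g) (ennreal a) \<le> ennreal ((K / a) powr enn2real p)"
      by simp
  qed
  then show "circ_avg \<theta> f g \<in> lorentz_space lebesgue p \<infinity>"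
    using red(1) by (auto simp: lorentz_space_def intro: le_less_trans)
qed

text \<open>With 1/p = 1/2 + 1/q, the power 1/2 - 1/q equals 1 - 1/p, so the conclusion is the
  tested form of a weak L^p bound.\<close>

lemma bilin_avg_lorentz:
  fixes f g :: "real^2 \<Rightarrow> complex"
  assumes K: "bilin_avg_level_bound \<theta> K"
    and f: "f \<in> lorentz_space lebesgue 2 1" and g: "g \<in> lorentz_space lebesgue q 1" and q: "2 \<le> q"
  obtains f' g' where
    "f' \<in> borel_measurable borel" "AE x in lborel. f x = f' x"
    "g' \<in> borel_measurable borel" "AE x in lborel. g x = g' x"
    "weak_bound (bilin_avg \<theta> (\<lambda>x. ennreal (norm (f' x))) (\<lambda>x. ennreal (norm (g' x))))
      (K * enn2real (lorentz_norm lebesgue 2 1 f) * enn2real (lorentz_norm lebesgue q 1 g)) (1 / 2 - 1 / enn2real q)"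
proof -
  let ?nf = "enn2real (lorentz_norm lebesgue 2 1 f)" and ?ng = "enn2real (lorentz_norm lebesgue q 1 g)"
  have fin: "lorentz_norm lebesgue 2 1 f = ennreal ?nf" "lorentz_norm lebesgue q 1 g = ennreal ?ng"
    using f g by (simp_all add: lorentz_space_def)
  obtain f' where f': "f' \<in> borel_measurable borel" "AE x in lborel. f x = f' x"
    and fb: "1 / enn2real 2 = 0 \<longrightarrow> (\<forall>x. norm (f' x) \<le> ?nf)"
    and fw: "(\<integral>\<^sup>+s. indicator {0..} s * superlevel_weight (\<lambda>x. norm (f' x)) ?nf (1 / enn2real 2) s \<partial>lborel)
        \<le> lorentz_norm lebesgue 2 1 f"
    using lorentz_space_representative[OF f order_refl] .
  obtain g' where g': "g' \<in> borel_measurable borel" "AE x in lborel. g x = g' x"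
    and gb: "1 / enn2real q = 0 \<longrightarrow> (\<forall>x. norm (g' x) \<le> ?ng)"
    and gw: "(\<integral>\<^sup>+s. indicator {0..} s * superlevel_weight (\<lambda>x. norm (g' x)) ?ng (1 / enn2real q) s \<partial>lborel)
        \<le> lorentz_norm lebesgue q 1 g"
    using lorentz_space_representative[OF g q] .
  note [measurable] = f'(1) g'(1)
  have fw': "(\<integral>\<^sup>+s. indicator {0..} s * epowr (emeasure lborel {y. s < norm (f' y)}) (1 / 2) \<partial>lborel) \<le> ennreal ?nf"
    using fw unfolding fin(1)[symmetric] by (simp add: superlevel_weight_def)
  have "weak_bound (bilin_avg \<theta> (\<lambda>x. ennreal (norm (f' x))) (\<lambda>x. ennreal (norm (g' x))))
      (K * ?nf * ?ng) (1 / 2 - 1 / enn2real q)"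
    unfolding weak_bound_def
  proof (intro allI impI)
    fix B :: "(real^2) set" and b
    assume B: "B \<in> sets borel" "emeasure lborel B = ennreal b" "0 < b"
    have K0: "0 \<le> K"
      using K by (simp add: bilin_avg_level_bound_def)
    have nm: "(\<lambda>x. norm (f' x)) \<in> borel_measurable borel" "(\<lambda>x. norm (g' x)) \<in> borel_measurable borel"
      by measurable
    have "(\<integral>\<^sup>+x. indicator B x * bilin_avg \<theta> (\<lambda>x. ennreal (norm (f' x))) (\<lambda>x. ennreal (norm (g' x))) x \<partial>lborel)
      \<le> ennreal K * (\<integral>\<^sup>+s. indicator {0..} s * epowr (emeasure lborel {y. s < norm (f' y)}) (1 / 2) \<partial>lborel)
        * (\<integral>\<^sup>+s. indicator {0..} s * superlevel_weight (\<lambda>x. norm (g' x)) ?ng (1 / enn2real q) s \<partial>lborel)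
        * ennreal (b powr (1 / 2 - 1 / enn2real q))"
      by (rule K[unfolded bilin_avg_level_bound_def, THEN conjunct2, rule_format])
         (intro conjI nm allI norm_ge_zero B exponent_le_half(1,2)[OF q] gb)
    also have "\<dots> \<le> ennreal K * ennreal ?nf * ennreal ?ng * ennreal (b powr (1 / 2 - 1 / enn2real q))"
      using fw' gw fin by (intro mult_right_mono mult_mono mult_left_mono) simp_all
    also have "\<dots> = ennreal (K * ?nf * ?ng * b powr (1 / 2 - 1 / enn2real q))"
      using K0 by (simp add: ennreal_mult)
    finally show "(\<integral>\<^sup>+x. indicator B x * bilin_avg \<theta> (\<lambda>x. ennreal (norm (f' x))) (\<lambda>x. ennreal (norm (g' x))) x \<partial>lborel)
      \<le> ennreal (K * ?nf * ?ng * b powr (1 / 2 - 1 / enn2real q))" .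
  qed
  with f' g' show thesis
    by (rule that)
qed

lemma exponent_endpoint:
  assumes "2 \<le> (q :: ennreal)" and p: "1 / 2 + 1 / q = 1 / p"
  shows "p \<noteq> \<infinity>" "0 < enn2real p" "1 - 1 / enn2real p = 1 / 2 - 1 / enn2real q"
proof -
  have q: "0 < q"
    using assms(1) by (rule less_le_trans[rotated]) simp
  have eq: "1 / enn2real p = 1 / 2 + 1 / enn2real q"
    using exponent_sum(2)[OF _ q p] by simp
  then show "1 - 1 / enn2real p = 1 / 2 - 1 / enn2real q"
    by simp
  have "0 \<le> 1 / enn2real q"
    by simp
  with eq have "0 < 1 / enn2real p"
    by linarith
  then show "0 < enn2real p"
    by simp
  then show "p \<noteq> \<infinity>"
    by auto
qed

lemma circ_avg_weak:
  assumes \<theta>: "0 < \<theta>" "\<theta> < 2 * pi" and p12: "2 \<le> p1" "2 \<le> p2" "p1 = 2 \<or> p2 = 2"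
    and p: "1 / p1 + 1 / p2 = 1 / p"
  shows "\<exists>C::real. 0 \<le> C \<and>
          (\<forall>f \<in> lorentz_space lebesgue p1 1. \<forall>g \<in> lorentz_space lebesgue p2 1.
             circ_avg_defined \<theta> f g \<and>
             circ_avg \<theta> f g \<in> lorentz_space lebesgue p \<infinity> \<and>
             lorentz_norm lebesgue p \<infinity> (circ_avg \<theta> f g)
               \<le> ennreal C * lorentz_norm lebesgue p1 1 f * lorentz_norm lebesgue p2 1 g)"
proof -
  have norm_real: "ennreal K * lorentz_norm lebesgue q1 1 f * lorentz_norm lebesgue q2 1 g
      = ennreal (K * enn2real (lorentz_norm lebesgue q1 1 f) * enn2real (lorentz_norm lebesgue q2 1 g))"
    if "0 \<le> K" "f \<in> lorentz_space lebesgue q1 1" "g \<in> lorentz_space lebesgue q2 1"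
    for K q1 q2 and f g :: "real^2 \<Rightarrow> complex"
    using that by (simp add: lorentz_space_def ennreal_mult)
  show ?thesis
  proof (cases "p1 = 2")
    case True
    note e = exponent_endpoint[OF p12(2) p[unfolded True]]
    obtain K where K: "bilin_avg_level_bound \<theta> K"
      using ex_bilin_avg_level_bound[OF \<theta>] ..
    then have K0: "0 \<le> K"
      by (simp add: bilin_avg_level_bound_def)
    show ?thesis
      unfolding True
    proof (intro exI[of _ K] conjI[OF K0] ballI)
      fix f g :: "real^2 \<Rightarrow> complex"
      assume fg: "f \<in> lorentz_space lebesgue 2 1" "g \<in> lorentz_space lebesgue p2 1"
      obtain f' g' where f': "f' \<in> borel_measurable borel" "AE x in lborel. f x = f' x"
        and g': "g' \<in> borel_measurable borel" "AE x in lborel. g x = g' x"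
        and b: "weak_bound (bilin_avg \<theta> (\<lambda>x. ennreal (norm (f' x))) (\<lambda>x. ennreal (norm (g' x))))
          (K * enn2real (lorentz_norm lebesgue 2 1 f) * enn2real (lorentz_norm lebesgue p2 1 g)) (1 - 1 / enn2real p)"
        using bilin_avg_lorentz[OF K fg p12(2)] unfolding e(3) .
      show "circ_avg_defined \<theta> f g \<and> circ_avg \<theta> f g \<in> lorentz_space lebesgue p \<infinity> \<and>
             lorentz_norm lebesgue p \<infinity> (circ_avg \<theta> f g)
               \<le> ennreal K * lorentz_norm lebesgue 2 1 f * lorentz_norm lebesgue p2 1 g"
        unfolding norm_real[OF K0 fg] using circ_avg_weak_of_bound[OF \<theta> f' g' e(1,2) _ b] K0 by simp
    qed
  next
    case False
    then have p2: "p2 = 2" using p12 by simp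
    have p': "1 / 2 + 1 / p1 = 1 / p"
      using p by (simp add: p2 add.commute)
    note e = exponent_endpoint[OF p12(1) p']
    obtain K where K: "bilin_avg_level_bound (2 * pi - \<theta>) K"
      using ex_bilin_avg_level_bound[of "2 * pi - \<theta>"] \<theta> by auto
    then have K0: "0 \<le> K"
      by (simp add: bilin_avg_level_bound_def)
    show ?thesis
      unfolding p2
    proof (intro exI[of _ K] conjI[OF K0] ballI)
      fix f g :: "real^2 \<Rightarrow> complex"
      assume fg: "f \<in> lorentz_space lebesgue p1 1" "g \<in> lorentz_space lebesgue 2 1"
      let ?nf = "enn2real (lorentz_norm lebesgue p1 1 f)" and ?ng = "enn2real (lorentz_norm lebesgue 2 1 g)"
      obtain g' f' where g': "g' \<in> borel_measurable borel" "AE x in lborel. g x = g' x"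
        and f': "f' \<in> borel_measurable borel" "AE x in lborel. f x = f' x"
        and b: "weak_bound (bilin_avg (2 * pi - \<theta>) (\<lambda>x. ennreal (norm (g' x))) (\<lambda>x. ennreal (norm (f' x))))
          (K * ?ng * ?nf) (1 - 1 / enn2real p)"
        using bilin_avg_lorentz[OF K fg(2,1) p12(1)] unfolding e(3) .
      note [measurable] = f'(1) g'(1)
      have swap: "bilin_avg (2 * pi - \<theta>) (\<lambda>x. ennreal (norm (g' x))) (\<lambda>x. ennreal (norm (f' x)))
          = bilin_avg \<theta> (\<lambda>x. ennreal (norm (f' x))) (\<lambda>x. ennreal (norm (g' x)))"
        using \<theta> by (intro bilin_avg_swap[symmetric]) auto
      have comm: "K * ?ng * ?nf = K * ?nf * ?ng"
        by simp
      show "circ_avg_defined \<theta> f g \<and> circ_avg \<theta> f g \<in> lorentz_space lebesgue p \<infinity> \<and>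
             lorentz_norm lebesgue p \<infinity> (circ_avg \<theta> f g)
               \<le> ennreal K * lorentz_norm lebesgue p1 1 f * lorentz_norm lebesgue 2 1 g"
        unfolding norm_real[OF K0 fg]
        using circ_avg_weak_of_bound[OF \<theta> f' g' e(1,2) _ b[unfolded swap comm]] K0 by simp
    qed
  qed
qed

theorem theorem1p13:
  fixes \<theta> :: real
  assumes "0 < \<theta>" and "\<theta> < 2 * pi"
  shows
    "(\<forall>p1 p2 p :: ennreal.
        2 < p1 \<longrightarrow> 2 < p2 \<longrightarrow> 1 / p1 + 1 / p2 = 1 / p \<longrightarrow>
        (\<exists>C::real. 0 \<le> C \<and>
          (\<forall>f \<in> Lp_space lebesgue p1. \<forall>g \<in> Lp_space lebesgue p2.
             circ_avg_defined \<theta> f g \<and>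
             circ_avg \<theta> f g \<in> Lp_space lebesgue p \<and>
             Lp_norm lebesgue p (circ_avg \<theta> f g)
               \<le> ennreal C * Lp_norm lebesgue p1 f * Lp_norm lebesgue p2 g)))
     \<and>
     (\<forall>p1 p2 p :: ennreal.
        2 \<le> p1 \<longrightarrow> 2 \<le> p2 \<longrightarrow> (p1 = 2 \<or> p2 = 2) \<longrightarrow> 1 / p1 + 1 / p2 = 1 / p \<longrightarrow>
        (\<exists>C::real. 0 \<le> C \<and>
          (\<forall>f \<in> lorentz_space lebesgue p1 1. \<forall>g \<in> lorentz_space lebesgue p2 1.
             circ_avg_defined \<theta> f g \<and>
             circ_avg \<theta> f g \<in> lorentz_space lebesgue p \<infinity> \<and>
             lorentz_norm lebesgue p \<infinity> (circ_avg \<theta> f g)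
               \<le> ennreal C * lorentz_norm lebesgue p1 1 f * lorentz_norm lebesgue p2 1 g)))"
  using circ_avg_strong[OF assms] circ_avg_weak[OF assms] by blast

end
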